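(* Let $G$ be an infinite finitely generated group of subexponential growth, let $S$ be a finite set of generators of $G$, and for $n\in\mathbb{N}$ let $U_n\subseteq G$ be the set of elements of $G$ represented by (reduced) words over $S\cup S^{-1}$ of length at most $n$. Let $Q$ be a finite set with $|Q|\ge 2$, and let $X=Q^G/\!\sim_B$, where $c_1\sim_B c_2$ iff $$\lim_{n\to\infty}\frac{|\{g\in U_n: c_1(g)\neq c_2(g)\}|}{|U_n|}=0 ,$$ endowed with the topology induced by the distance $$d_B(x_1,x_2)=\limsup_{n\to\infty}\frac{|\{g\in U_n: c_1(g)\neq c_2(g)\}|}{|U_n|},\qquad c_1\in x_1,\ c_2\in x_2 .$$ Let $\mathcal{A}$ be a cellular automaton over $G$ with set of states $Q$ and global evolution function $F_{\mathcal{A}}:Q^G\to Q^G$. Then: 1. $\mathcal{A}$ induces in a natural way a Lipschitz continuous map $F:X\to X$; that is, $F([c])=[F_{\mathcal{A}}(c)]$ is well defined and there is $L>0$ with $d_B(F(x_1),F(x_2))\le L\, d_B(x_1,x_2)$ for all $x_1,x_2\in X$. 2. $F$ is surjective if and only if $F_{\mathcal{A}}$ is surjective. 3. $F$ is injective if and only if it is invertible (i.e. bijective). Moreover, if $G$ is of polynomial growth, then: 4. $d_B$ is invariant by translations, i.e. (with $d_B$ also denoting the pseudodistance on $Q^G$ given by the same formula) $d_B(c_1^g,c_2^g)=d_B(c_1,c_2)$ for all $c_1,c_2\in Q^G$ and $g\in G$. 5. The equivalence classes of $\sim_B$ are the same for every choice of the finite set of generators $S$.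
   Context: For a finite set of generators $S$ of $G$, the growth function is $\gamma_S(n)=|U_n|$ (the cardinality of the ball of radius $n$ around the identity in the word metric). $G$ is of subexponential growth if for every $\lambda>1$ one has $\gamma_S(n)\le\lambda^n$ for all sufficiently large $n$. $G$ is of polynomial growth if there exist $k\in\mathbb{N}$, constants $C_1,C_2>0$ and $n_0$ such that $C_1n^k\le\gamma_S(n)\le C_2n^k$ for all $n\ge n_0$. These properties do not depend on the choice of $S$. For $c\in Q^G$ and $g\in G$, the translate $c^g\in Q^G$ is defined by $c^g(h)=c(gh)$. A cellular automaton over $G$ is a triple $\mathcal{A}=\langle Q,\mathcal{N},f\rangle$ where $Q$ is a finite set with at least two elements (the set of states), $\mathcal{N}\subseteq G$ is finite and nonempty, and $f:Q^{\mathcal{N}}\to Q$. Its global evolution function $F_{\mathcal{A}}:Q^G\to Q^G$ is $(F_{\mathcal{A}}(c))(g)=f\big((c^g)|_{\mathcal{N}}\big)$. *)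

theory Defs
  imports "HOL-Analysis.Analysis" "HOL-Algebra.Generated_Groups"
begin

definition finite_generating_set :: "('g, 'm) monoid_scheme \<Rightarrow> 'g set \<Rightarrow> bool" where
  "finite_generating_set G S \<longleftrightarrow> finite S \<and> S \<subseteq> carrier G \<and> generate G S = carrier G"

text \<open>Whether or not the words are required to be reduced makes no difference:
  cancelling only shortens a word.\<close>

definition word_ball :: "('g, 'm) monoid_scheme \<Rightarrow> 'g set \<Rightarrow> nat \<Rightarrow> 'g set" where
  "word_ball G S n =
    {foldr (\<otimes>\<^bsub>G\<^esub>) w \<one>\<^bsub>G\<^esub> |w. set w \<subseteq> S \<union> (\<lambda>s. inv\<^bsub>G\<^esub> s) ` S \<and> length w \<le> n}"

definition growth :: "('g, 'm) monoid_scheme \<Rightarrow> 'g set \<Rightarrow> nat \<Rightarrow> nat" where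
  "growth G S n = card (word_ball G S n)"

text \<open>Both growth conditions hold for one finite generating set iff they hold for all of them;
  the existential form makes them properties of the group alone.\<close>

definition subexponential_growth :: "('g, 'm) monoid_scheme \<Rightarrow> bool" where
  "subexponential_growth G \<longleftrightarrow>
    (\<exists>S. finite_generating_set G S \<and>
      (\<forall>l::real. l > 1 \<longrightarrow> (\<exists>n0. \<forall>n\<ge>n0. real (growth G S n) \<le> l ^ n)))"

definition polynomial_growth :: "('g, 'm) monoid_scheme \<Rightarrow> bool" where
  "polynomial_growth G \<longleftrightarrow>
    (\<exists>S. finite_generating_set G S \<and>
      (\<exists>(k::nat) (C1::real) (C2::real) n0. C1 > 0 \<and> C2 > 0 \<and>
        (\<forall>n\<ge>n0. C1 * real n ^ k \<le> real (growth G S n) \<and>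
                real (growth G S n) \<le> C2 * real n ^ k)))"

text \<open>A configuration is represented by its extensional extension to the whole type, so that
  equality of configurations is equality of functions.\<close>

definition configs :: "('g, 'm) monoid_scheme \<Rightarrow> 'q set \<Rightarrow> ('g \<Rightarrow> 'q) set" where
  "configs G Q = (carrier G \<rightarrow>\<^sub>E Q)"

definition translate :: "('g, 'm) monoid_scheme \<Rightarrow> ('g \<Rightarrow> 'q) \<Rightarrow> 'g \<Rightarrow> ('g \<Rightarrow> 'q)" where
  "translate G c g = (\<lambda>h\<in>carrier G. c (g \<otimes>\<^bsub>G\<^esub> h))"

definition cellular_automaton ::
    "('g, 'm) monoid_scheme \<Rightarrow> 'q set \<Rightarrow> 'g set \<Rightarrow> (('g \<Rightarrow> 'q) \<Rightarrow> 'q) \<Rightarrow> bool" where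
  "cellular_automaton G Q N f \<longleftrightarrow>
    finite Q \<and> card Q \<ge> 2 \<and>
    N \<subseteq> carrier G \<and> finite N \<and> N \<noteq> {} \<and>
    f \<in> (N \<rightarrow>\<^sub>E Q) \<rightarrow> Q"

definition global_map ::
    "('g, 'm) monoid_scheme \<Rightarrow> 'g set \<Rightarrow> (('g \<Rightarrow> 'q) \<Rightarrow> 'q) \<Rightarrow> ('g \<Rightarrow> 'q) \<Rightarrow> ('g \<Rightarrow> 'q)" where
  "global_map G N f c = (\<lambda>g\<in>carrier G. f (restrict (translate G c g) N))"

definition difference_density ::
    "('g, 'm) monoid_scheme \<Rightarrow> 'g set \<Rightarrow> ('g \<Rightarrow> 'q) \<Rightarrow> ('g \<Rightarrow> 'q) \<Rightarrow> nat \<Rightarrow> real" where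
  "difference_density G S c1 c2 n =
    real (card {g \<in> word_ball G S n. c1 g \<noteq> c2 g}) / real (card (word_ball G S n))"

definition besicovitch_rel ::
    "('g, 'm) monoid_scheme \<Rightarrow> 'g set \<Rightarrow> 'q set \<Rightarrow> (('g \<Rightarrow> 'q) \<times> ('g \<Rightarrow> 'q)) set" where
  "besicovitch_rel G S Q =
    {(c1, c2). c1 \<in> configs G Q \<and> c2 \<in> configs G Q \<and> difference_density G S c1 c2 \<longlonglongrightarrow> 0}"

definition besicovitch_space ::
    "('g, 'm) monoid_scheme \<Rightarrow> 'g set \<Rightarrow> 'q set \<Rightarrow> ('g \<Rightarrow> 'q) set set" where
  "besicovitch_space G S Q = configs G Q // besicovitch_rel G S Q"

definition besicovitch_class ::
    "('g, 'm) monoid_scheme \<Rightarrow> 'g set \<Rightarrow> 'q set \<Rightarrow> ('g \<Rightarrow> 'q) \<Rightarrow> ('g \<Rightarrow> 'q) set" where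
  "besicovitch_class G S Q c = besicovitch_rel G S Q `` {c}"

text \<open>The limit superior is taken in the extended reals; since the densities lie in
  \<open>{0..1}\<close> the conversion back to the reals loses nothing.\<close>

definition besicovitch_pseudodist ::
    "('g, 'm) monoid_scheme \<Rightarrow> 'g set \<Rightarrow> ('g \<Rightarrow> 'q) \<Rightarrow> ('g \<Rightarrow> 'q) \<Rightarrow> real" where
  "besicovitch_pseudodist G S c1 c2 =
    real_of_ereal (limsup (\<lambda>n. ereal (difference_density G S c1 c2 n)))"

text \<open>The choice of representatives is immaterial, see \<open>besicovitch_dist_eq\<close> below.\<close>

definition besicovitch_dist ::
    "('g, 'm) monoid_scheme \<Rightarrow> 'g set \<Rightarrow> ('g \<Rightarrow> 'q) set \<Rightarrow> ('g \<Rightarrow> 'q) set \<Rightarrow> real" where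
  "besicovitch_dist G S x1 x2 =
    besicovitch_pseudodist G S (SOME c. c \<in> x1) (SOME c. c \<in> x2)"

lemma finite_word_ball:
  assumes "finite S"
  shows "finite (word_ball G S n)"
proof -
  let ?A = "S \<union> (\<lambda>s. inv\<^bsub>G\<^esub> s) ` S"
  have "word_ball G S n =
      (\<lambda>w. foldr (\<otimes>\<^bsub>G\<^esub>) w \<one>\<^bsub>G\<^esub>) ` {w. set w \<subseteq> ?A \<and> length w \<le> n}"
    by (auto simp: word_ball_def)
  moreover have "finite {w. set w \<subseteq> ?A \<and> length w \<le> n}"
    by (rule finite_lists_length_le) (use assms in simp)
  ultimately show ?thesis by simp
qed

lemma difference_density_nonneg: "0 \<le> difference_density G S c1 c2 n"
  by (simp add: difference_density_def)

lemma difference_density_le_1: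
  assumes "finite S"
  shows "difference_density G S c1 c2 n \<le> 1"
proof -
  have "card {g \<in> word_ball G S n. c1 g \<noteq> c2 g} \<le> card (word_ball G S n)"
    by (rule card_mono) (use assms finite_word_ball in auto)
  then show ?thesis by (cases "card (word_ball G S n) = 0") (simp_all add: difference_density_def)
qed

lemma difference_density_same: "difference_density G S c c n = 0"
  by (simp add: difference_density_def)

lemma difference_density_commute: "difference_density G S c1 c2 = difference_density G S c2 c1"
  by (rule ext) (simp add: difference_density_def eq_commute)

lemma difference_density_triangle:
  assumes "finite S"
  shows "difference_density G S c1 c3 n
    \<le> difference_density G S c1 c2 n + difference_density G S c2 c3 n"
proof -
  let ?D = "\<lambda>c d. {g \<in> word_ball G S n. c g \<noteq> d g}"
  have "card (?D c1 c3) \<le> card (?D c1 c2 \<union> ?D c2 c3)"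
    by (rule card_mono) (auto simp: finite_word_ball[OF assms])
  also have "\<dots> \<le> card (?D c1 c2) + card (?D c2 c3)"
    by (rule card_Un_le)
  finally have "real (card (?D c1 c3)) \<le> real (card (?D c1 c2)) + real (card (?D c2 c3))"
    by linarith
  then show ?thesis
    by (simp add: difference_density_def flip: add_divide_distrib) (simp add: divide_right_mono)
qed

lemma equiv_besicovitch_rel:
  assumes "finite S"
  shows "equiv (configs G Q) (besicovitch_rel G S Q)"
proof (rule equivI)
  show "besicovitch_rel G S Q \<subseteq> configs G Q \<times> configs G Q"
    by (auto simp: besicovitch_rel_def)
  show "refl_on (configs G Q) (besicovitch_rel G S Q)"
  proof (rule refl_onI)
    fix c assume "c \<in> configs G Q"
    moreover have "difference_density G S c c = (\<lambda>n. 0)"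
      by (rule ext) (rule difference_density_same)
    ultimately show "(c, c) \<in> besicovitch_rel G S Q"
      by (simp add: besicovitch_rel_def)
  qed
  show "sym (besicovitch_rel G S Q)"
    by (auto simp: sym_def besicovitch_rel_def difference_density_commute)
  show "trans (besicovitch_rel G S Q)"
  proof (rule transI)
    fix c1 c2 c3
    assume 12: "(c1, c2) \<in> besicovitch_rel G S Q" and 23: "(c2, c3) \<in> besicovitch_rel G S Q"
    have "(\<lambda>n. difference_density G S c1 c2 n + difference_density G S c2 c3 n) \<longlonglongrightarrow> 0 + 0"
      by (rule tendsto_add) (use 12 23 in \<open>auto simp: besicovitch_rel_def\<close>)
    then have "(\<lambda>n. difference_density G S c1 c2 n + difference_density G S c2 c3 n) \<longlonglongrightarrow> 0"
      by simp
    moreover have "\<forall>\<^sub>F n in sequentially. norm (difference_density G S c1 c3 n)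
        \<le> difference_density G S c1 c2 n + difference_density G S c2 c3 n"
      by (simp add: difference_density_nonneg difference_density_triangle[OF assms])
    ultimately have "difference_density G S c1 c3 \<longlonglongrightarrow> 0"
      by (rule Lim_null_comparison[rotated])
    then show "(c1, c3) \<in> besicovitch_rel G S Q"
      using 12 23 by (auto simp: besicovitch_rel_def)
  qed
qed

lemma ereal_besicovitch_pseudodist:
  assumes "finite S"
  shows "ereal (besicovitch_pseudodist G S c1 c2)
    = limsup (\<lambda>n. ereal (difference_density G S c1 c2 n))"
proof -
  let ?l = "limsup (\<lambda>n. ereal (difference_density G S c1 c2 n))"
  have "?l \<le> 1"
    by (rule Limsup_bounded) (simp add: difference_density_le_1[OF assms])
  moreover have "0 \<le> ?l"
    by (rule le_Limsup) (simp_all add: difference_density_nonneg)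
  ultimately have "\<bar>?l\<bar> \<noteq> \<infinity>" by auto
  then show ?thesis by (simp add: besicovitch_pseudodist_def ereal_real')
qed

lemma besicovitch_pseudodist_nonneg: "0 \<le> besicovitch_pseudodist G S c1 c2"
  unfolding besicovitch_pseudodist_def
  by (intro real_of_ereal_pos le_Limsup) (simp_all add: difference_density_nonneg)

lemma besicovitch_pseudodist_commute:
  "besicovitch_pseudodist G S c1 c2 = besicovitch_pseudodist G S c2 c1"
  by (simp add: besicovitch_pseudodist_def difference_density_commute[of G S c1 c2])

lemma besicovitch_pseudodist_triangle:
  assumes "finite S"
  shows "besicovitch_pseudodist G S c1 c3
    \<le> besicovitch_pseudodist G S c1 c2 + besicovitch_pseudodist G S c2 c3"
proof -
  have "ereal (besicovitch_pseudodist G S c1 c3)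
      \<le> limsup (\<lambda>n. ereal (difference_density G S c1 c2 n) + ereal (difference_density G S c2 c3 n))"
    unfolding ereal_besicovitch_pseudodist[OF assms]
    by (rule Limsup_mono) (simp add: difference_density_triangle[OF assms])
  also have "\<dots> \<le> limsup (\<lambda>n. ereal (difference_density G S c1 c2 n))
      + limsup (\<lambda>n. ereal (difference_density G S c2 c3 n))"
    by (rule ereal_limsup_add_mono)
  finally show ?thesis
    by (simp flip: ereal_besicovitch_pseudodist[OF assms])
qed

lemma besicovitch_pseudodist_eq_0_iff:
  assumes "finite S"
  shows "besicovitch_pseudodist G S c1 c2 = 0 \<longleftrightarrow> difference_density G S c1 c2 \<longlonglongrightarrow> 0"
proof
  let ?u = "\<lambda>n. ereal (difference_density G S c1 c2 n)"
  assume "besicovitch_pseudodist G S c1 c2 = 0"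
  then have sup: "limsup ?u = 0"
    using ereal_besicovitch_pseudodist[OF assms, of G c1 c2] by (simp flip: zero_ereal_def)
  have "0 \<le> liminf ?u"
    by (rule Liminf_bounded) (simp add: difference_density_nonneg)
  moreover have "liminf ?u \<le> limsup ?u"
    by (rule Liminf_le_Limsup) simp
  ultimately have "?u \<longlonglongrightarrow> 0"
    using sup by (intro Liminf_eq_Limsup) auto
  then show "difference_density G S c1 c2 \<longlonglongrightarrow> 0"
    using lim_ereal[of "difference_density G S c1 c2" 0] by (simp flip: zero_ereal_def)
next
  assume "difference_density G S c1 c2 \<longlonglongrightarrow> 0"
  then have "(\<lambda>n. ereal (difference_density G S c1 c2 n)) \<longlonglongrightarrow> ereal 0"
    by simp
  then have "limsup (\<lambda>n. ereal (difference_density G S c1 c2 n)) = 0"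
    by (simp add: lim_imp_Limsup flip: zero_ereal_def)
  then show "besicovitch_pseudodist G S c1 c2 = 0"
    by (simp add: besicovitch_pseudodist_def)
qed

lemma besicovitch_dist_eq:
  assumes "finite S"
    and x1: "x1 \<in> besicovitch_space G S Q" "c1 \<in> x1"
    and x2: "x2 \<in> besicovitch_space G S Q" "c2 \<in> x2"
  shows "besicovitch_dist G S x1 x2 = besicovitch_pseudodist G S c1 c2"
proof -
  let ?d = "besicovitch_pseudodist G S"
  have zero: "?d c (SOME c. c \<in> x) = 0" "?d (SOME c. c \<in> x) c = 0"
    if "x \<in> besicovitch_space G S Q" "c \<in> x" for x c
  proof -
    have "(SOME c. c \<in> x) \<in> x" using that(2) by (rule someI[of "\<lambda>c. c \<in> x"])
    then have "(c, SOME c. c \<in> x) \<in> besicovitch_rel G S Q"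
      using that quotient_eq_iff[OF equiv_besicovitch_rel[OF \<open>finite S\<close>],
          of x G Q x c "SOME c. c \<in> x"]
      by (simp add: besicovitch_space_def)
    then show "?d c (SOME c. c \<in> x) = 0"
      by (simp add: besicovitch_rel_def besicovitch_pseudodist_eq_0_iff[OF \<open>finite S\<close>])
    then show "?d (SOME c. c \<in> x) c = 0"
      by (simp add: besicovitch_pseudodist_commute)
  qed
  note tri = besicovitch_pseudodist_triangle[OF \<open>finite S\<close>, of G]
  show ?thesis
    unfolding besicovitch_dist_def
    using zero[OF x1] zero[OF x2]
      tri[of "SOME c. c \<in> x1" "SOME c. c \<in> x2" c1] tri[of c1 "SOME c. c \<in> x2" c2]
      tri[of c1 c2 "SOME c. c \<in> x1"] tri[of "SOME c. c \<in> x1" c2 "SOME c. c \<in> x2"]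
    by linarith
qed

lemma Metric_space_besicovitch:
  fixes G :: "('g, 'm) monoid_scheme" and Q :: "'q set"
  assumes "finite S"
  shows "Metric_space (besicovitch_space G S Q) (besicovitch_dist G S)"
proof (rule Metric_space.intro)
  let ?e = "\<lambda>x. SOME c. c \<in> x"
  fix x y z :: "('g \<Rightarrow> 'q) set"
  show "0 \<le> besicovitch_dist G S x y"
    by (simp add: besicovitch_dist_def besicovitch_pseudodist_nonneg)
  show "besicovitch_dist G S x y = besicovitch_dist G S y x"
    by (simp add: besicovitch_dist_def besicovitch_pseudodist_commute)
  show "besicovitch_dist G S x z \<le> besicovitch_dist G S x y + besicovitch_dist G S y z"
    by (simp add: besicovitch_dist_def besicovitch_pseudodist_triangle[OF assms])
  assume x: "x \<in> besicovitch_space G S Q" and y: "y \<in> besicovitch_space G S Q"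
  note eqv = equiv_besicovitch_rel[OF assms, of G Q]
  have ex: "?e w \<in> w \<and> ?e w \<in> configs G Q" if "w \<in> besicovitch_space G S Q" for w
  proof -
    have w: "w \<in> configs G Q // besicovitch_rel G S Q"
      using that by (simp add: besicovitch_space_def)
    have "?e w \<in> w"
      using in_quotient_imp_non_empty[OF eqv w] by (simp add: some_in_eq)
    with in_quotient_imp_subset[OF eqv w] show ?thesis by (simp add: subset_iff)
  qed
  have "besicovitch_dist G S x y = 0 \<longleftrightarrow> (?e x, ?e y) \<in> besicovitch_rel G S Q"
    using ex[OF x] ex[OF y]
    by (simp add: besicovitch_dist_def besicovitch_rel_def besicovitch_pseudodist_eq_0_iff[OF assms])
  also have "\<dots> \<longleftrightarrow> x = y"
    using quotient_eq_iff[OF eqv] x y ex[OF x] ex[OF y] unfolding besicovitch_space_def by metis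
  finally show "besicovitch_dist G S x y = 0 \<longleftrightarrow> x = y" .
qed

end

theory Submission
  imports Defs
begin

text \<open>Write \<open>U\<^sub>n\<close> for the ball of radius \<open>n\<close>. The one fact about words that everything rests on is
  \<open>U\<^bsub>m+n\<^esub> = U\<^sub>m U\<^sub>n\<close>.

  The automaton is Lipschitz because a change of one cell is seen by at most \<open>|N|\<close> cells at bounded
  distance, and passing from \<open>U\<^sub>n\<close> to \<open>U\<^bsub>n+r\<^esub>\<close> costs at most the factor \<open>|U\<^sub>r|\<close>. So a map on classes is
  induced.

  Surjectivity and injectivity on classes are compared with properties of finite patterns. A maximal
  family of disjoint translates \<open>z U\<^sub>R\<close> meets every large ball in a positive proportion of its points,
  so a pattern that is copied onto all of them matters in the Besicovitch distance. If the global map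
  is not surjective, compactness provides an orphan, a pattern that occurs in no image
  (\<open>orphan_exists\<close>); a configuration that is full of orphans is at positive distance from every image
  (\<open>orphan_config_isolated\<close>), hence the induced map is not surjective either.

  For injectivity, Moore's half of the Garden of Eden theorem (\<open>erasable_pair_exists\<close>) turns an orphan
  into two distinct configurations that differ at finitely many cells and have the same image. This is
  where subexponential growth enters: it makes some balls \<open>U\<^bsub>n+s\<^esub>\<close> barely larger than \<open>U\<^sub>n\<close>, so that
  the patterns on \<open>U\<^sub>n\<close> outnumber the orphan-free patterns on \<open>U\<^bsub>n+s\<^esub>\<close>. Copying the two
  configurations onto all tiles gives two configurations at positive distance with the same image
  (\<open>erasable_pair_dense\<close>). An injective induced map is therefore surjective.

  Polynomial growth gives a doubling condition on balls, for any generating set. In a length metric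
  doubling forces thin shells to be negligible (\<open>card_shell_le\<close>, an argument of Colding, Minicozzi and
  Tessera), that is \<open>|U\<^bsub>n+r\<^esub>| / |U\<^sub>n|\<close> tends to 1 for each \<open>r\<close>, and translating by an element of \<open>U\<^sub>r\<close> only moves cells
  from \<open>U\<^sub>n\<close> into \<open>U\<^bsub>n+r\<^esub>\<close>. Balls of comparable radius for two generating sets have comparable size, so
  the same pairs of configurations have difference density tending to 0.\<close>

section \<open>Balls in the word metric\<close>

locale group_with_generators = group G for G (structure) +
  fixes S
  assumes generators: "finite_generating_set G S"
begin

abbreviation U :: "nat \<Rightarrow> 'a set" where
  "U n \<equiv> word_ball G S n"

abbreviation letters :: "'a set" where
  "letters \<equiv> S \<union> (\<lambda>s. inv s) ` S"

abbreviation eval_word :: "'a list \<Rightarrow> 'a" where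
  "eval_word w \<equiv> foldr (\<otimes>) w \<one>"

lemma finite_generators: "finite S"
  and generators_subset: "S \<subseteq> carrier G"
  and generate_generators: "generate G S = carrier G"
  using generators by (auto simp: finite_generating_set_def)

lemma letters_subset: "letters \<subseteq> carrier G"
  using generators_subset by auto

lemma finite_ball [simp]: "finite (U n)"
  by (rule finite_word_ball[OF finite_generators])

lemma word_in_ball: "set w \<subseteq> letters \<Longrightarrow> length w \<le> n \<Longrightarrow> eval_word w \<in> U n"
  by (auto simp: word_ball_def)

lemma ball_wordE:
  assumes "x \<in> U n"
  obtains w where "set w \<subseteq> letters" "length w \<le> n" "x = eval_word w"
  using assms by (auto simp: word_ball_def)

lemma eval_word_closed: "set w \<subseteq> carrier G \<Longrightarrow> eval_word w \<in> carrier G"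
  by (induction w) auto

lemma eval_word_append:
  "set v \<subseteq> carrier G \<Longrightarrow> set w \<subseteq> carrier G \<Longrightarrow>
    eval_word (v @ w) = eval_word v \<otimes> eval_word w"
  by (induction v) (auto simp: eval_word_closed m_assoc)

lemma inv_eval_word:
  "set w \<subseteq> carrier G \<Longrightarrow> inv (eval_word w) = eval_word (rev (map (\<lambda>s. inv s) w))"
proof (induction w)
  case (Cons a w)
  then have "inv (eval_word (a # w)) = inv (eval_word w) \<otimes> inv a"
    by (simp add: eval_word_closed inv_mult_group)
  also have "\<dots> = eval_word (rev (map (\<lambda>s. inv s) w)) \<otimes> eval_word [inv a]"
    using Cons by simp
  also have "\<dots> = eval_word (rev (map (\<lambda>s. inv s) w) @ [inv a])"
    by (subst eval_word_append[symmetric]) (use Cons.prems in auto)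
  finally show ?case by simp
qed simp

lemma ball_subset: "U n \<subseteq> carrier G"
  using eval_word_closed letters_subset by (auto elim!: ball_wordE)

lemma ball_closed: "x \<in> U n \<Longrightarrow> x \<in> carrier G"
  using ball_subset by blast

lemma one_in_ball [simp]: "\<one> \<in> U n"
  using word_in_ball[of "[]" n] by simp

lemma ball_mono: "m \<le> n \<Longrightarrow> U m \<subseteq> U n"
  by (fastforce simp: word_ball_def)

lemma ball_mult:
  assumes "x \<in> U m" "y \<in> U n"
  shows "x \<otimes> y \<in> U (m + n)"
proof -
  obtain v where v: "set v \<subseteq> letters" "length v \<le> m" "x = eval_word v"
    using assms(1) by (rule ball_wordE)
  obtain w where w: "set w \<subseteq> letters" "length w \<le> n" "y = eval_word w"
    using assms(2) by (rule ball_wordE)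
  have "x \<otimes> y = eval_word (v @ w)"
    unfolding v w by (rule eval_word_append[symmetric]) (use v w letters_subset in blast)+
  also have "\<dots> \<in> U (m + n)"
    by (rule word_in_ball) (use v w in auto)
  finally show ?thesis .
qed

lemma ball_inv:
  assumes "x \<in> U n"
  shows "inv x \<in> U n"
proof -
  obtain w where w: "set w \<subseteq> letters" "length w \<le> n" "x = eval_word w"
    using assms by (rule ball_wordE)
  have "inv x = eval_word (rev (map (\<lambda>s. inv s) w))"
    using inv_eval_word[of w] w letters_subset by auto
  also have "\<dots> \<in> U n"
  proof (rule word_in_ball)
    have "(\<lambda>s. inv s) ` letters \<subseteq> letters"
      using generators_subset by (auto simp: image_iff subset_iff)
    then show "set (rev (map (\<lambda>s. inv s) w)) \<subseteq> letters"
      using w(1) by (simp only: set_rev set_map) blast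
  qed (use w in auto)
  finally show ?thesis .
qed

text \<open>Cutting a word after its first \<open>m\<close> letters. This is what makes the word metric behave
  like a length metric.\<close>

lemma ball_split:
  assumes "x \<in> U (m + n)"
  obtains y u where "y \<in> U m" "u \<in> U n" "x = y \<otimes> u"
proof -
  obtain w where w: "set w \<subseteq> letters" "length w \<le> m + n" "x = eval_word w"
    using assms by (rule ball_wordE)
  have sub: "set (take m w) \<subseteq> letters" "set (drop m w) \<subseteq> letters"
    using w(1) set_take_subset[of m w] set_drop_subset[of m w] by blast+
  have "x = eval_word (take m w) \<otimes> eval_word (drop m w)"
    using sub letters_subset w(3)
    by (subst eval_word_append[symmetric]) (auto simp only: append_take_drop_id)
  moreover have "eval_word (take m w) \<in> U m"
    by (rule word_in_ball) (use sub in auto)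
  moreover have "eval_word (drop m w) \<in> U n"
    by (rule word_in_ball) (use sub w in auto)
  ultimately show thesis using that by blast
qed

lemma letter_in_ball: "s \<in> letters \<Longrightarrow> s \<in> U 1"
  using word_in_ball[of "[s]" 1] letters_subset by (auto simp del: One_nat_def)

lemma balls_exhaust:
  assumes "x \<in> carrier G"
  obtains n where "x \<in> U n"
proof -
  have "x \<in> generate G S" using assms generate_generators by simp
  then have "\<exists>n. x \<in> U n"
  proof induction
    case one
    show ?case by auto
  next
    case (incl h)
    then show ?case using letter_in_ball by blast
  next
    case (inv h)
    then show ?case using letter_in_ball by blast
  next
    case (eng h1 h2)
    then show ?case using ball_mult by blast
  qed
  then show thesis using that by blast
qed

lemma finite_subset_ball:
  assumes "finite A" "A \<subseteq> carrier G"
  obtains n where "A \<subseteq> U n"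
proof -
  have "\<exists>n. A \<subseteq> U n"
    using assms
  proof (induction A)
    case (insert x A)
    then obtain m where "A \<subseteq> U m" by auto
    moreover obtain n where "x \<in> U n" using insert balls_exhaust by blast
    ultimately have "insert x A \<subseteq> U (max m n)"
      using ball_mono[of m "max m n"] ball_mono[of n "max m n"] by auto
    then show ?case by blast
  qed simp
  then show thesis using that by blast
qed

lemma card_ball_pos: "0 < card (U n)"
  using one_in_ball[of n] by (simp add: card_gt_0_iff del: one_in_ball) blast

lemma card_ball_mono: "m \<le> n \<Longrightarrow> card (U m) \<le> card (U n)"
  by (simp add: ball_mono card_mono)

lemma card_ball_add: "card (U (m + n)) \<le> card (U m) * card (U n)"
proof -
  have "U (m + n) \<subseteq> (\<lambda>(y, u). y \<otimes> u) ` (U m \<times> U n)"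
    by (auto elim!: ball_split)
  then have "card (U (m + n)) \<le> card (U m \<times> U n)"
    by (rule surj_card_le[rotated]) simp
  then show ?thesis by (simp add: card_cartesian_product)
qed

text \<open>Each letter over \<open>T\<close> is a word of bounded length over \<open>S\<close>; substituting these words multiplies
  lengths by at most a constant.\<close>

lemma ball_change_generators:
  assumes "group_with_generators G T"
  obtains a where "a \<ge> 1" "\<And>n. word_ball G T n \<subseteq> U (a * n)"
proof -
  interpret T: group_with_generators G T by (rule assms)
  have "finite T.letters" using T.finite_generators by simp
  from finite_subset_ball[OF this T.letters_subset]
  obtain b where b: "T.letters \<subseteq> U b" .
  define a where "a = Suc b"
  have a: "T.letters \<subseteq> U a" using b ball_mono[of b a] by (auto simp: a_def)
  have word: "eval_word w \<in> U (a * length w)" if "set w \<subseteq> T.letters" for w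
    using that
  proof (induction w)
    case (Cons s w)
    then have "s \<otimes> eval_word w \<in> U (a + a * length w)"
      using a by (intro ball_mult) auto
    then show ?case by simp
  qed simp
  have "word_ball G T n \<subseteq> U (a * n)" for n
  proof
    fix x assume "x \<in> word_ball G T n"
    then obtain w where w: "set w \<subseteq> T.letters" "length w \<le> n" "x = eval_word w"
      by (rule T.ball_wordE)
    then have "x \<in> U (a * length w)" by (simp add: word)
    then show "x \<in> U (a * n)" using ball_mono[OF mult_le_mono2[OF w(2)]] by blast
  qed
  then show thesis using that[of a] by (simp add: a_def)
qed

end

section \<open>Sparse tilings\<close>

context group_with_generators
begin

text \<open>The translates \<open>z U\<^sub>R\<close> with \<open>z \<in> Z\<close> are disjoint, and no further disjoint translate
  fits in; the covering clause is the form in which maximality is used.\<close>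

definition tiling :: "nat \<Rightarrow> 'a set \<Rightarrow> bool" where
  "tiling R Z \<longleftrightarrow> Z \<subseteq> carrier G \<and>
    (\<forall>z\<in>Z. \<forall>z'\<in>Z. \<forall>u\<in>U R. \<forall>u'\<in>U R. z \<otimes> u = z' \<otimes> u' \<longrightarrow> z = z') \<and>
    (\<forall>g\<in>carrier G. \<exists>z\<in>Z. \<exists>u\<in>U (2 * R). g = z \<otimes> u)"

lemma tiling_subset: "tiling R Z \<Longrightarrow> Z \<subseteq> carrier G"
  by (simp add: tiling_def)

lemma tiling_disjoint:
  "tiling R Z \<Longrightarrow> z \<in> Z \<Longrightarrow> z' \<in> Z \<Longrightarrow> u \<in> U R \<Longrightarrow> u' \<in> U R \<Longrightarrow>
    z \<otimes> u = z' \<otimes> u' \<Longrightarrow> z = z'"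
  unfolding tiling_def by blast

lemma tiling_cover:
  assumes "tiling R Z" "g \<in> carrier G"
  obtains z u where "z \<in> Z" "u \<in> U (2 * R)" "g = z \<otimes> u"
  using assms unfolding tiling_def by blast

lemma tiling_exists:
  obtains Z where "tiling R Z"
proof -
  define disj where "disj Z \<longleftrightarrow>
    (\<forall>z\<in>Z. \<forall>z'\<in>Z. \<forall>u\<in>U R. \<forall>u'\<in>U R. z \<otimes> u = z' \<otimes> u' \<longrightarrow> z = z')" for Z
  let ?A = "{Z. Z \<subseteq> carrier G \<and> disj Z}"
  have "\<Union>C \<in> ?A" if C: "subset.chain ?A C" for C
  proof -
    have "disj (\<Union>C)"
      unfolding disj_def
    proof (intro ballI impI)
      fix z z' u u'
      assume z: "z \<in> \<Union>C" "z' \<in> \<Union>C" and u: "u \<in> U R" "u' \<in> U R" "z \<otimes> u = z' \<otimes> u'"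
      obtain X Y where "X \<in> C" "z \<in> X" "Y \<in> C" "z' \<in> Y" using z by blast
      then obtain W where "W \<in> C" "z \<in> W" "z' \<in> W"
        using C unfolding subset_chain_def by (metis subsetD)
      moreover from this have "disj W" using C unfolding subset.chain_def by blast
      ultimately show "z = z'" using u unfolding disj_def by blast
    qed
    moreover have "\<Union>C \<subseteq> carrier G"
      using C unfolding subset.chain_def by blast
    ultimately show ?thesis by simp
  qed
  from subset_Zorn'[of ?A, OF this]
  obtain Z where "Z \<in> ?A" and maximal: "\<forall>X\<in>?A. Z \<subseteq> X \<longrightarrow> X = Z" ..
  then have Z: "Z \<subseteq> carrier G" "disj Z" by simp_all
  have max: "X = Z" if "X \<subseteq> carrier G" "disj X" "Z \<subseteq> X" for X
    using maximal that by simp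
  have "\<exists>z\<in>Z. \<exists>u\<in>U (2 * R). g = z \<otimes> u" if g: "g \<in> carrier G" for g
  proof (cases "g \<in> Z")
    case True
    then show ?thesis using g by (intro bexI[of _ g] bexI[of _ \<one>]) auto
  next
    case False
    have "\<exists>z\<in>Z. \<exists>u\<in>U R. \<exists>u'\<in>U R. g \<otimes> u = z \<otimes> u'"
    proof (rule ccontr)
      assume free: "\<not> ?thesis"
      have "disj (insert g Z)"
        unfolding disj_def
      proof (intro ballI impI)
        fix z z' u u'
        assume z: "z \<in> insert g Z" "z' \<in> insert g Z"
          and u: "u \<in> U R" "u' \<in> U R" and eq: "z \<otimes> u = z' \<otimes> u'"
        consider "z = g" "z' = g" | "z = g" "z' \<in> Z" | "z \<in> Z" "z' = g" | "z \<in> Z" "z' \<in> Z"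
          using z by blast
        then show "z = z'"
        proof cases
          case 2
          then show ?thesis using free u eq by blast
        next
          case 3
          then show ?thesis using free u eq[symmetric] by blast
        next
          case 4
          then show ?thesis using Z(2) u eq unfolding disj_def by blast
        qed simp
      qed
      then show False using max[of "insert g Z"] g Z False by blast
    qed
    then obtain z u u' where z: "z \<in> Z" "u \<in> U R" "u' \<in> U R" "g \<otimes> u = z \<otimes> u'"
      by blast
    have closed: "z \<in> carrier G" "u \<in> carrier G" "u' \<in> carrier G"
      using z Z ball_closed by auto
    have "g = z \<otimes> (u' \<otimes> inv u)"
      using z(4) closed g by (metis inv_closed inv_solve_right m_assoc m_closed)
    moreover have "u' \<otimes> inv u \<in> U (2 * R)"
      using ball_mult[OF z(3) ball_inv[OF z(2)]] by (simp add: mult_2)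
    ultimately show ?thesis using z(1) by blast
  qed
  then have "tiling R Z"
    using Z unfolding tiling_def disj_def by blast
  then show thesis by (rule that)
qed

definition tile_cost :: "nat \<Rightarrow> nat" where
  "tile_cost R = card (U (2 * R)) * card (U (3 * R))"

lemma tile_cost_pos: "0 < tile_cost R"
  by (simp add: tile_cost_def card_ball_pos)

text \<open>Up to the boundary layer of width \<open>3 R\<close>, each ball is covered by the translates \<open>z U\<^bsub>2R\<^esub>\<close>
  whose tile \<open>z U\<^sub>R\<close> lies inside it. The factor \<open>|U\<^bsub>3R\<^esub>|\<close> restores the boundary layer.\<close>

lemma card_ball_le_tiles:
  assumes Z: "tiling R Z" and n: "3 * R \<le> n"
  shows "card (U n) \<le> tile_cost R * card (Z \<inter> U (n - R))"
proof -
  have "U (n - 3 * R) \<subseteq> (\<lambda>(z, u). z \<otimes> u) ` ((Z \<inter> U (n - R)) \<times> U (2 * R))"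
  proof
    fix g assume g: "g \<in> U (n - 3 * R)"
    obtain z u where zu: "z \<in> Z" "u \<in> U (2 * R)" "g = z \<otimes> u"
      using tiling_cover[OF Z ball_closed[OF g]] .
    have "z = g \<otimes> inv u"
      using zu tiling_subset[OF Z] ball_closed by (simp add: subset_iff inv_solve_right)
    also have "\<dots> \<in> U (n - 3 * R + 2 * R)"
      by (intro ball_mult ball_inv g zu)
    finally have "z \<in> U (n - R)" using n by simp
    then show "g \<in> (\<lambda>(z, u). z \<otimes> u) ` ((Z \<inter> U (n - R)) \<times> U (2 * R))"
      using zu by auto
  qed
  then have "card (U (n - 3 * R)) \<le> card ((Z \<inter> U (n - R)) \<times> U (2 * R))"
    by (rule surj_card_le[rotated]) simp
  then have "card (U (n - 3 * R)) \<le> card (Z \<inter> U (n - R)) * card (U (2 * R))"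
    by (simp add: card_cartesian_product)
  moreover have "card (U n) \<le> card (U (n - 3 * R)) * card (U (3 * R))"
    using card_ball_add[of "n - 3 * R" "3 * R"] n by simp
  ultimately show ?thesis
    by (smt (verit) mult.assoc mult.commute mult_le_mono2 le_trans tile_cost_def)
qed

lemma card_ball_le_hits:
  assumes Z: "tiling R Z" and n: "3 * R \<le> n"
    and hit: "\<And>z. z \<in> Z \<Longrightarrow> \<exists>u\<in>U R. P (z \<otimes> u)"
  shows "card (U n) \<le> tile_cost R * card {g \<in> U n. P g}"
proof -
  obtain h where h: "\<And>z. z \<in> Z \<Longrightarrow> h z \<in> U R" "\<And>z. z \<in> Z \<Longrightarrow> P (z \<otimes> h z)"
    using hit by metis
  have "inj_on (\<lambda>z. z \<otimes> h z) (Z \<inter> U (n - R))"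
    by (rule inj_onI) (use tiling_disjoint[OF Z] h in blast)
  moreover have "(\<lambda>z. z \<otimes> h z) ` (Z \<inter> U (n - R)) \<subseteq> {g \<in> U n. P g}"
    using ball_mult[of _ "n - R" _ R] h n by auto
  ultimately have "card (Z \<inter> U (n - R)) \<le> card {g \<in> U n. P g}"
    by (intro card_inj_on_le) auto
  then show ?thesis
    using card_ball_le_tiles[OF Z n] by (meson le_trans mult_le_mono2)
qed

text \<open>The tiles inside \<open>U\<^sub>n\<close> are at least a fixed proportion of \<open>|U\<^sub>n|\<close> in number, and each of them
  contributes a difference of its own.\<close>

lemma pseudodist_pos:
  assumes Z: "tiling R Z"
    and diff: "\<And>z. z \<in> Z \<Longrightarrow> \<exists>u\<in>U R. c1 (z \<otimes> u) \<noteq> c2 (z \<otimes> u)"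
  shows "besicovitch_pseudodist G S c1 c2 \<noteq> 0"
proof
  let ?K = "real (tile_cost R)"
  assume "besicovitch_pseudodist G S c1 c2 = 0"
  then have "difference_density G S c1 c2 \<longlonglongrightarrow> 0"
    by (simp add: besicovitch_pseudodist_eq_0_iff finite_generators)
  then have "eventually (\<lambda>n. difference_density G S c1 c2 n < 1 / ?K) sequentially"
    by (rule order_tendstoD) (simp add: tile_cost_pos)
  then have "eventually (\<lambda>n. difference_density G S c1 c2 n < 1 / ?K \<and> 3 * R \<le> n) sequentially"
    using eventually_ge_at_top by (rule eventually_conj)
  then obtain n where n: "difference_density G S c1 c2 n < 1 / ?K" "3 * R \<le> n"
    using eventually_happens' by (metis (no_types, lifting) trivial_limit_sequentially)
  have "card (U n) \<le> tile_cost R * card {g \<in> U n. c1 g \<noteq> c2 g}"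
    by (rule card_ball_le_hits[OF Z n(2) diff])
  then have "real (card (U n)) \<le> ?K * real (card {g \<in> U n. c1 g \<noteq> c2 g})"
    unfolding of_nat_mult[symmetric] of_nat_le_iff .
  then have "1 / ?K \<le> difference_density G S c1 c2 n"
    using tile_cost_pos[of R] card_ball_pos[of n]
    by (simp add: difference_density_def divide_simps mult.commute)
  with n(1) show False by simp
qed

text \<open>The copies do not conflict: the tiles being disjoint, a cell \<open>z \<otimes> u\<close> determines \<open>z\<close>
  and hence its place \<open>u\<close> in the tile.\<close>

lemma paste_on_tiles:
  assumes Z: "tiling R Z" and c: "c \<in> configs G Q" and q: "q \<in> Q"
  obtains e where "e \<in> configs G Q"
    and "\<forall>z\<in>Z. \<forall>u\<in>U R. e (z \<otimes> u) = c u"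
    and "\<forall>g\<in>carrier G. (\<forall>z\<in>Z. \<forall>u\<in>U R. g \<noteq> z \<otimes> u) \<longrightarrow> e g = q"
proof -
  define inside where "inside g p \<longleftrightarrow> fst p \<in> Z \<and> snd p \<in> U R \<and> g = fst p \<otimes> snd p" for g p
  define e where "e = (\<lambda>g\<in>carrier G. if \<exists>p. inside g p then c (snd (SOME p. inside g p)) else q)"
  have c_in: "c u \<in> Q" if "u \<in> carrier G" for u
    using c that by (auto simp: configs_def)
  have unique: "p = p'" if "inside g p" "inside g p'" for g p p'
  proof -
    have "fst p = fst p'"
      using that tiling_disjoint[OF Z, of "fst p" "fst p'" "snd p" "snd p'"]
      by (simp add: inside_def)
    moreover have "fst p \<in> carrier G" "snd p \<in> carrier G" "snd p' \<in> carrier G"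
      using that tiling_subset[OF Z] ball_closed by (auto simp: inside_def)
    ultimately have "snd p = snd p'"
      using that by (simp add: inside_def)
    with \<open>fst p = fst p'\<close> show ?thesis by (simp add: prod_eq_iff)
  qed
  show thesis
  proof (rule that)
    show "e \<in> configs G Q"
    proof -
      have "e g \<in> Q" if "g \<in> carrier G" for g
      proof (cases "\<exists>p. inside g p")
        case True
        then have "inside g (SOME p. inside g p)" by (rule someI_ex)
        then have "snd (SOME p. inside g p) \<in> carrier G"
          using ball_closed by (auto simp: inside_def)
        then show ?thesis using True that c_in by (simp add: e_def)
      qed (use that q in \<open>simp add: e_def\<close>)
      then show ?thesis by (auto simp: configs_def e_def)
    qed
    show "\<forall>z\<in>Z. \<forall>u\<in>U R. e (z \<otimes> u) = c u"
    proof (intro ballI)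
      fix z u assume zu: "z \<in> Z" "u \<in> U R"
      then have "inside (z \<otimes> u) (z, u)" by (simp add: inside_def)
      moreover from this have "(SOME p. inside (z \<otimes> u) p) = (z, u)"
        using unique by blast
      moreover have "z \<otimes> u \<in> carrier G"
        using zu tiling_subset[OF Z] ball_closed by blast
      ultimately show "e (z \<otimes> u) = c u" by (auto simp: e_def)
    qed
    show "\<forall>g\<in>carrier G. (\<forall>z\<in>Z. \<forall>u\<in>U R. g \<noteq> z \<otimes> u) \<longrightarrow> e g = q"
      by (auto simp: e_def inside_def)
  qed
qed

end

section \<open>Cellular automata\<close>

locale automaton_on_group = group G for G (structure) +
  fixes Q N f
  assumes automaton: "cellular_automaton G Q N f"
begin

abbreviation C :: "('a \<Rightarrow> 'c) set" where
  "C \<equiv> configs G Q"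

abbreviation \<Phi> :: "('a \<Rightarrow> 'c) \<Rightarrow> ('a \<Rightarrow> 'c)" where
  "\<Phi> \<equiv> global_map G N f"

lemma finite_states: "finite Q"
  and card_states: "card Q \<ge> 2"
  and neighbourhood_subset: "N \<subseteq> carrier G"
  and finite_neighbourhood: "finite N"
  and neighbourhood_nonempty: "N \<noteq> {}"
  and local_rule_closed: "p \<in> N \<rightarrow>\<^sub>E Q \<Longrightarrow> f p \<in> Q"
  using automaton by (auto simp: cellular_automaton_def)

lemma config_closed: "c \<in> C \<Longrightarrow> g \<in> carrier G \<Longrightarrow> c g \<in> Q"
  by (auto simp: configs_def)

lemma config_eqI:
  "c \<in> C \<Longrightarrow> d \<in> C \<Longrightarrow> (\<And>g. g \<in> carrier G \<Longrightarrow> c g = d g) \<Longrightarrow> c = d"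
  unfolding configs_def by (rule PiE_ext)

lemma translate_config: "c \<in> C \<Longrightarrow> g \<in> carrier G \<Longrightarrow> translate G c g \<in> C"
  by (auto simp: configs_def translate_def)

lemma global_map_apply:
  assumes "g \<in> carrier G"
  shows "\<Phi> c g = f (\<lambda>\<nu>\<in>N. c (g \<otimes> \<nu>))"
proof -
  have "restrict (translate G c g) N = (\<lambda>\<nu>\<in>N. c (g \<otimes> \<nu>))"
    using neighbourhood_subset by (auto simp: translate_def restrict_def fun_eq_iff)
  then show ?thesis using assms by (simp add: global_map_def)
qed

lemma global_map_cong:
  assumes "g \<in> carrier G" "h \<in> carrier G" "\<And>\<nu>. \<nu> \<in> N \<Longrightarrow> c (g \<otimes> \<nu>) = d (h \<otimes> \<nu>)"
  shows "\<Phi> c g = \<Phi> d h"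
proof -
  have "(\<lambda>\<nu>\<in>N. c (g \<otimes> \<nu>)) = (\<lambda>\<nu>\<in>N. d (h \<otimes> \<nu>))"
    using assms(3) by (rule restrict_ext)
  then show ?thesis using assms by (simp add: global_map_apply)
qed

lemma global_map_config:
  assumes "c \<in> C"
  shows "\<Phi> c \<in> C"
proof -
  have "\<Phi> c g \<in> Q" if "g \<in> carrier G" for g
  proof -
    have "(\<lambda>\<nu>\<in>N. c (g \<otimes> \<nu>)) \<in> N \<rightarrow>\<^sub>E Q"
      using config_closed[OF assms] that neighbourhood_subset by auto
    then show ?thesis using local_rule_closed that by (simp add: global_map_apply)
  qed
  then show ?thesis by (auto simp: configs_def global_map_def)
qed

lemma global_map_translate:
  assumes "g \<in> carrier G" "h \<in> carrier G"
  shows "\<Phi> (translate G c g) h = \<Phi> c (g \<otimes> h)"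
  using assms neighbourhood_subset
  by (intro global_map_cong) (auto simp: translate_def m_assoc)

end

locale automaton_with_generators = group_with_generators G S + automaton_on_group G Q N f
  for G (structure) and S Q N f
begin

lemma neighbourhood_radius:
  obtains s where "N \<subseteq> U s"
  using finite_subset_ball[OF finite_neighbourhood neighbourhood_subset] .

text \<open>A condition that looks at finitely many cells is a union of cylinders.\<close>

lemma openin_locally_determined:
  assumes E: "finite E" "E \<subseteq> carrier G"
    and det: "\<And>x y. x \<in> C \<Longrightarrow> y \<in> C \<Longrightarrow> (\<And>g. g \<in> E \<Longrightarrow> x g = y g) \<Longrightarrow> P x \<Longrightarrow> P y"
  shows "openin (product_topology (\<lambda>_. discrete_topology Q) (carrier G)) {x \<in> C. P x}"
proof (rule iffD2[OF openin_subopen], intro ballI)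
  fix x assume x: "x \<in> {x \<in> C. P x}"
  let ?T = "PiE (carrier G) (\<lambda>g. if g \<in> E then {x g} else Q)"
  have "openin (product_topology (\<lambda>_. discrete_topology Q) (carrier G)) ?T"
  proof (rule product_topology_basis)
    show "openin (discrete_topology Q) (if g \<in> E then {x g} else Q)" for g
      using x E config_closed by auto
    show "finite {g. (if g \<in> E then {x g} else Q) \<noteq> topspace (discrete_topology Q)}"
      by (rule finite_subset[OF _ E(1)]) auto
  qed
  moreover have "x \<in> ?T"
    using x by (auto simp: configs_def PiE_iff)
  moreover have "?T \<subseteq> {x \<in> C. P x}"
  proof
    fix y assume y: "y \<in> ?T"
    have yE: "x g = y g" if "g \<in> E" for g
      using PiE_mem[OF y, of g] that E by auto
    have "y g \<in> Q" if "g \<in> carrier G" for g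
      using y x that config_closed[of x g] by (auto simp: PiE_iff split: if_splits)
    then have "y \<in> C" using y by (auto simp: configs_def PiE_iff)
    moreover have "P y" using det[of x y] x yE \<open>y \<in> C\<close> by blast
    ultimately show "y \<in> {x \<in> C. P x}" by simp
  qed
  ultimately show "\<exists>T. openin (product_topology (\<lambda>_. discrete_topology Q) (carrier G)) T \<and>
      x \<in> T \<and> T \<subseteq> {x \<in> C. P x}"
    by blast
qed

text \<open>Compactness of the configuration space: if every finite part of \<open>c\<close> had a preimage, the
  closed sets of configurations that are correct on larger and larger balls would be nested and
  nonempty, and a common point would be a preimage of \<open>c\<close>.\<close>

lemma orphan_exists:
  assumes c: "c \<in> C" "c \<notin> \<Phi> ` C"
  obtains R where "\<And>x. x \<in> C \<Longrightarrow> \<exists>u\<in>U R. \<Phi> x u \<noteq> c u"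
proof -
  let ?X = "product_topology (\<lambda>_. discrete_topology Q) (carrier G)"
  let ?K = "\<lambda>n. {x \<in> C. \<forall>u\<in>U n. \<Phi> x u = c u}"
  have top: "topspace ?X = C" by (simp add: configs_def)
  have "\<exists>R. ?K R = {}"
  proof (rule ccontr)
    assume ne: "\<not> (\<exists>R. ?K R = {})"
    have "(\<Inter>n. ?K n) \<noteq> {}"
    proof (rule compact_space_imp_nest)
      show "compact_space ?X"
        by (simp add: compact_space_product_topology compact_space_discrete_topology finite_states)
      show "closedin ?X (?K n)" for n
      proof -
        let ?E = "(\<lambda>(g, \<nu>). g \<otimes> \<nu>) ` (U n \<times> N)"
        have "openin ?X {x \<in> C. \<not> (\<forall>u\<in>U n. \<Phi> x u = c u)}"
        proof (rule openin_locally_determined)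
          show "finite ?E" using finite_neighbourhood by simp
          show "?E \<subseteq> carrier G" using ball_subset neighbourhood_subset by auto
          fix x y assume xy: "\<And>g. g \<in> ?E \<Longrightarrow> x g = y g"
            and x: "\<not> (\<forall>u\<in>U n. \<Phi> x u = c u)"
          have "\<Phi> x u = \<Phi> y u" if "u \<in> U n" for u
            by (rule global_map_cong) (use that ball_closed xy in auto)
          then show "\<not> (\<forall>u\<in>U n. \<Phi> y u = c u)" using x by simp
        qed
        moreover have "topspace ?X - ?K n = {x \<in> C. \<not> (\<forall>u\<in>U n. \<Phi> x u = c u)}"
          unfolding top by blast
        ultimately show ?thesis unfolding closedin_def using top by auto
      qed
      show "?K n \<noteq> {}" for n using ne by blast
      show "decseq ?K" using ball_mono by (auto simp: decseq_def)
    qed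
    then obtain x where x: "\<And>n. x \<in> ?K n" by blast
    have "\<Phi> x = c"
    proof (rule config_eqI)
      show "\<Phi> x \<in> C" using x global_map_config by blast
      show "\<Phi> x g = c g" if "g \<in> carrier G" for g
        using balls_exhaust[OF that] x by blast
    qed (rule c)
    moreover have "x \<in> C" using x by blast
    ultimately show False using c(2) by blast
  qed
  then show thesis using that by blast
qed

lemma orphan_translate:
  assumes orphan: "\<And>x. x \<in> C \<Longrightarrow> \<exists>u\<in>U R. \<Phi> x u \<noteq> c u"
    and x: "x \<in> C" and z: "z \<in> carrier G"
  shows "\<exists>u\<in>U R. \<Phi> x (z \<otimes> u) \<noteq> c u"
  using orphan[OF translate_config[OF x z]] global_map_translate[OF z] ball_closed by metis

end

section \<open>Mutually erasable patterns\<close>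

text \<open>Forbidding one pattern on a block of \<open>t\<close> cells multiplies the number of fillings of that
  block by \<open>1 - q\<^sup>-\<^sup>t\<close>, where \<open>q\<close> is the number of states, and disjoint blocks are independent.
  The inequality is multiplied out in order to stay within the natural numbers.\<close>

lemma card_avoiding_le:
  fixes T :: "'z \<Rightarrow> 'a set" and p :: "'z \<Rightarrow> 'a \<Rightarrow> 'q"
  assumes "finite Z" "finite Q" "finite E"
    and "\<And>z. z \<in> Z \<Longrightarrow> T z \<subseteq> E" "\<And>z. z \<in> Z \<Longrightarrow> card (T z) = t"
    and "\<And>z. z \<in> Z \<Longrightarrow> p z \<in> T z \<rightarrow>\<^sub>E Q"
    and "\<And>z z'. z \<in> Z \<Longrightarrow> z' \<in> Z \<Longrightarrow> z \<noteq> z' \<Longrightarrow> T z \<inter> T z' = {}"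
  shows "card {x \<in> E \<rightarrow>\<^sub>E Q. \<forall>z\<in>Z. restrict x (T z) \<noteq> p z} * card Q ^ (t * card Z)
    \<le> card Q ^ card E * (card Q ^ t - 1) ^ card Z"
  using assms
proof (induction Z arbitrary: E rule: finite_induct)
  case empty
  have "{x \<in> E \<rightarrow>\<^sub>E Q. \<forall>z\<in>{}. restrict x (T z) \<noteq> p z} = E \<rightarrow>\<^sub>E Q" by auto
  then show ?case using empty by (simp add: card_funcsetE)
next
  case (insert z Z)
  let ?good = "\<lambda>E Z. {x \<in> E \<rightarrow>\<^sub>E Q. \<forall>z\<in>Z. restrict x (T z) \<noteq> p z}"
  let ?rest = "E - T z"
  let ?block = "(T z \<rightarrow>\<^sub>E Q) - {p z}"
  have Tz: "T z \<subseteq> E" "card (T z) = t" "p z \<in> T z \<rightarrow>\<^sub>E Q" "finite (T z)"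
    using insert.prems by (auto intro: finite_subset)
  have disj: "T z' \<subseteq> ?rest" if "z' \<in> Z" for z'
    using that insert.hyps insert.prems(3)[of z'] insert.prems(6)[of z z'] by blast
  have IH: "card (?good ?rest Z) * card Q ^ (t * card Z)
      \<le> card Q ^ card ?rest * (card Q ^ t - 1) ^ card Z"
    by (rule insert.IH) (use insert.prems disj in auto)
  have "inj_on (\<lambda>x. (restrict x (T z), restrict x ?rest)) (?good E (insert z Z))"
  proof (rule inj_onI)
    fix x y assume x: "x \<in> ?good E (insert z Z)" and y: "y \<in> ?good E (insert z Z)"
      and eq: "(restrict x (T z), restrict x ?rest) = (restrict y (T z), restrict y ?rest)"
    show "x = y"
    proof (rule PiE_ext)
      show "x \<in> E \<rightarrow>\<^sub>E Q" "y \<in> E \<rightarrow>\<^sub>E Q" using x y by auto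
      show "x g = y g" if "g \<in> E" for g
        using that eq by (cases "g \<in> T z") (metis DiffI prod.inject restrict_apply')+
    qed
  qed
  moreover have "(\<lambda>x. (restrict x (T z), restrict x ?rest)) ` ?good E (insert z Z)
      \<subseteq> ?block \<times> ?good ?rest Z"
  proof (rule image_subsetI)
    fix x assume x: "x \<in> ?good E (insert z Z)"
    have "restrict (restrict x ?rest) (T z') \<noteq> p z'" if "z' \<in> Z" for z'
      using x that disj[OF that] by (simp add: Int_absorb1)
    then show "(restrict x (T z), restrict x ?rest) \<in> ?block \<times> ?good ?rest Z"
      using x Tz by (auto simp: PiE_iff)
  qed
  moreover have "finite (?block \<times> ?good ?rest Z)"
    using insert.prems Tz by (simp add: finite_PiE)
  ultimately have "card (?good E (insert z Z)) \<le> card (?block \<times> ?good ?rest Z)"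
    by (rule card_inj_on_le)
  also have "\<dots> = (card Q ^ t - 1) * card (?good ?rest Z)"
    using Tz by (simp add: card_cartesian_product card_Diff_singleton card_funcsetE)
  finally have "card (?good E (insert z Z)) * card Q ^ (t * card (insert z Z))
      \<le> (card Q ^ t - 1) * card (?good ?rest Z) * card Q ^ (t * card (insert z Z))"
    by (rule mult_le_mono1)
  also have "\<dots> = (card Q ^ t - 1) * card Q ^ t * (card (?good ?rest Z) * card Q ^ (t * card Z))"
    using insert.hyps by (simp add: power_add algebra_simps)
  also have "\<dots> \<le> (card Q ^ t - 1) * card Q ^ t *
      (card Q ^ card ?rest * (card Q ^ t - 1) ^ card Z)"
    by (rule mult_le_mono2) (rule IH)
  also have "\<dots> = card Q ^ (t + card ?rest) * (card Q ^ t - 1) ^ card (insert z Z)"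
    using insert.hyps by (simp add: power_add algebra_simps)
  also have "t + card ?rest = card E"
    using Tz insert.prems(2) card_mono[OF insert.prems(2) Tz(1)] by (simp add: card_Diff_subset)
  finally show ?case .
qed

context group_with_generators
begin

text \<open>If every step of length \<open>s\<close> enlarged the balls by a factor \<open>1 + \<eta>\<close>, the growth would be
  exponential.\<close>

lemma slow_growth_step:
  fixes \<eta> :: real
  assumes subexp: "\<And>l::real. l > 1 \<Longrightarrow> \<exists>n0. \<forall>n\<ge>n0. real (card (U n)) \<le> l ^ n"
    and \<eta>: "\<eta> > 0"
  obtains n where "n \<ge> n0" "real (card (U (n + s))) < (1 + \<eta>) * real (card (U n))"
proof -
  have "\<exists>n\<ge>n0. real (card (U (n + s))) < (1 + \<eta>) * real (card (U n))"
  proof (rule ccontr)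
    assume "\<not> ?thesis"
    then have step: "(1 + \<eta>) * real (card (U n)) \<le> real (card (U (n + Suc s)))" if "n \<ge> n0" for n
      using that card_ball_mono[of "n + s" "n + Suc s"]
      by (meson le_trans nat_add_left_cancel_le not_less of_nat_le_iff order_trans
          Suc_n_not_le_n lessI less_imp_le)
    have grow: "(1 + \<eta>) ^ k \<le> real (card (U (n0 + k * Suc s)))" for k
    proof (induction k)
      case 0
      show ?case using card_ball_pos[of n0] by simp
    next
      case (Suc k)
      have "(1 + \<eta>) ^ Suc k \<le> (1 + \<eta>) * real (card (U (n0 + k * Suc s)))"
        using Suc \<eta> by simp
      also have "\<dots> \<le> real (card (U (n0 + k * Suc s + Suc s)))"
        by (rule step) simp
      finally show ?case by (simp add: algebra_simps)
    qed
    \<comment> \<open>A rate whose square over a step of length \<open>Suc s\<close> is still only \<open>1 + \<eta>\<close>.\<close>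
    define l where "l = root (2 * Suc s) (1 + \<eta>)"
    have l: "l > 1" "l ^ (2 * Suc s) = 1 + \<eta>"
      using \<eta> by (simp_all add: l_def del: power_Suc mult_Suc_right)
    obtain n1 where n1: "\<And>n. n \<ge> n1 \<Longrightarrow> real (card (U n)) \<le> l ^ n"
      using subexp[OF l(1)] by blast
    define k where "k = n0 + n1 + 1"
    have "l ^ (2 * Suc s * k) = (l ^ (2 * Suc s)) ^ k"
      by (rule power_mult)
    also have "\<dots> = (1 + \<eta>) ^ k"
      by (simp only: l(2))
    also have "\<dots> \<le> l ^ (n0 + k * Suc s)"
      by (rule order_trans[OF grow n1]) (simp add: k_def)
    finally have "2 * Suc s * k \<le> n0 + k * Suc s"
      using l(1) power_le_imp_le_exp by blast
    then have "Suc s * k \<le> n0" by (simp add: algebra_simps)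
    moreover have "k \<le> Suc s * k" by simp
    ultimately show False by (simp add: k_def)
  qed
  then show thesis using that by blast
qed

end

context automaton_with_generators
begin

text \<open>An orphan occurs nowhere in an image, so the images
  of the configurations supported in \<open>U\<^sub>n\<close> avoid a pattern on a positive proportion of disjoint
  blocks of \<open>U\<^bsub>n+s\<^esub>\<close>. Each block costs a fixed factor, so these images are exponentially fewer, in
  \<open>|U\<^bsub>n+s\<^esub>|\<close>, than the patterns on \<open>U\<^bsub>n+s\<^esub>\<close>. Where the balls grow slowly, they are even fewer than
  the patterns on \<open>U\<^sub>n\<close>, and two of the latter must collide. Extending a pattern by the state \<open>q\<close>
  keeps all images equal outside \<open>U\<^bsub>n+s\<^esub>\<close>, so that a collision there is a collision everywhere.\<close>

lemma erasable_pair_exists: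
  assumes subexp: "\<And>l::real. l > 1 \<Longrightarrow> \<exists>n0. \<forall>n\<ge>n0. real (card (U n)) \<le> l ^ n"
    and not_surj: "c \<in> C" "c \<notin> \<Phi> ` C"
  obtains c1 c2 where "c1 \<in> C" "c2 \<in> C" "c1 \<noteq> c2" "\<Phi> c1 = \<Phi> c2"
    "finite {g \<in> carrier G. c1 g \<noteq> c2 g}"
proof -
  obtain R where orphan: "\<And>x. x \<in> C \<Longrightarrow> \<exists>u\<in>U R. \<Phi> x u \<noteq> c u"
    using orphan_exists[OF not_surj] by blast
  obtain Z where Z: "tiling R Z" by (rule tiling_exists)
  obtain s where s: "N \<subseteq> U s" by (rule neighbourhood_radius)
  obtain q where q: "q \<in> Q" using card_states by fastforce
  define t where "t = card (U R)"
  define K where "K = real (tile_cost R)"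
  define \<Delta> where "\<Delta> = ln (real (card Q ^ t)) - ln (real (card Q ^ t - 1))"
  have lnq: "ln (real (card Q)) > 0" using card_states by simp
  have "2 \<le> card Q ^ t"
  proof -
    have "2 ^ 1 \<le> card Q ^ 1" using card_states by simp
    also have "\<dots> \<le> card Q ^ t"
      using card_states card_ball_pos[of R] by (intro power_increasing) (auto simp: t_def)
    finally show ?thesis by simp
  qed
  then have block: "0 < real (card Q ^ t - 1)" "real (card Q ^ t - 1) < real (card Q ^ t)"
    by linarith+
  then have \<Delta>: "\<Delta> > 0"
    unfolding \<Delta>_def diff_gt_0_iff_gt by (subst ln_less_cancel_iff) linarith+
  have K: "K > 0" using tile_cost_pos by (simp add: K_def)
  obtain n where n: "3 * R \<le> n"
    "real (card (U (n + s))) < (1 + \<Delta> / (K * ln (real (card Q)))) * real (card (U n))"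
    using slow_growth_step[OF subexp, of "\<Delta> / (K * ln (real (card Q)))" "3 * R" s] \<Delta> K lnq
    by (metis divide_pos_pos mult_pos_pos)
  define B where "B = U (n + s)"
  define A where "A = Z \<inter> U (n + s - R)"
  define T where "T z = (\<lambda>u. z \<otimes> u) ` U R" for z
  define p where "p z = (\<lambda>g\<in>T z. c (inv z \<otimes> g))" for z
  define good where "good = {x \<in> B \<rightarrow>\<^sub>E Q. \<forall>z\<in>A. restrict x (T z) \<noteq> p z}"
  define ext where "ext x = (\<lambda>g\<in>carrier G. if g \<in> U n then x g else q)" for x :: "'a \<Rightarrow> 'c"
  define image where "image x = restrict (\<Phi> (ext x)) B" for x
  have A: "z \<in> carrier G" "z \<in> Z" "z \<in> U (n + s - R)" if "z \<in> A" for z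
    using that tiling_subset[OF Z] by (auto simp: A_def)
  have TB: "T z \<subseteq> B" if "z \<in> A" for z
    using ball_mult[OF A(3)[OF that], of _ R] n(1) by (auto simp: T_def B_def)
  have p_apply: "p z (z \<otimes> u) = c u" if "z \<in> A" "u \<in> U R" for z u
    using that A(1)[OF that(1)] ball_closed[OF that(2)]
    by (auto simp: p_def T_def m_assoc[symmetric])
  have good_le: "card good * card Q ^ (t * card A) \<le> card Q ^ card B * (card Q ^ t - 1) ^ card A"
    unfolding good_def
  proof (rule card_avoiding_le)
    show "finite A" "finite Q" "finite B" by (simp_all add: A_def B_def finite_states)
    show "T z \<subseteq> B" if "z \<in> A" for z by (rule TB[OF that])
    show "card (T z) = t" if "z \<in> A" for z
      unfolding T_def t_def using A(1)[OF that] ball_closed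
      by (intro card_image inj_onI) simp
    show "p z \<in> T z \<rightarrow>\<^sub>E Q" if "z \<in> A" for z
    proof (rule PiE_I)
      fix g assume "g \<in> T z"
      then obtain u where "u \<in> U R" "g = z \<otimes> u" by (auto simp: T_def)
      then show "p z g \<in> Q"
        using p_apply[OF that] config_closed[OF not_surj(1)] ball_closed by simp
    qed (simp add: p_def)
    show "T z \<inter> T z' = {}" if "z \<in> A" "z' \<in> A" "z \<noteq> z'" for z z'
      using that A(2) tiling_disjoint[OF Z] by (fastforce simp: T_def)
  qed
  have ext: "ext x \<in> C" if "x \<in> U n \<rightarrow>\<^sub>E Q" for x
    using that q by (auto simp: ext_def configs_def PiE_iff)
  have image_good: "image ` (U n \<rightarrow>\<^sub>E Q) \<subseteq> good"
  proof (rule image_subsetI)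
    fix x assume x: "x \<in> U n \<rightarrow>\<^sub>E Q"
    have "image x \<in> B \<rightarrow>\<^sub>E Q"
      using config_closed[OF global_map_config[OF ext[OF x]]] ball_closed
      by (auto simp: image_def B_def)
    moreover have "restrict (image x) (T z) \<noteq> p z" if z: "z \<in> A" for z
    proof
      assume eq: "restrict (image x) (T z) = p z"
      obtain u where u: "u \<in> U R" "\<Phi> (ext x) (z \<otimes> u) \<noteq> c u"
        using orphan_translate[OF orphan ext[OF x] A(1)[OF z]] by blast
      have "z \<otimes> u \<in> T z" using u by (simp add: T_def)
      then have "p z (z \<otimes> u) = \<Phi> (ext x) (z \<otimes> u)"
        using TB[OF z] by (auto simp: image_def simp flip: eq)
      then show False using p_apply[OF z u(1)] u(2) by simp
    qed
    ultimately show "image x \<in> good" by (simp add: good_def)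
  qed
  have fin_good: "finite good"
    by (rule finite_subset[of _ "B \<rightarrow>\<^sub>E Q"]) (auto simp: good_def B_def finite_states intro!: finite_PiE)
  \<comment> \<open>In logarithms: the orphans save at least \<open>\<Delta>\<close> on each of the \<open>card A\<close> blocks, and the choice of
    \<open>n\<close> makes the cells of \<open>B\<close> outside \<open>U n\<close> contribute less than that.\<close>
  have "card good < card (U n \<rightarrow>\<^sub>E Q)"
  proof (rule ccontr)
    assume "\<not> ?thesis"
    then have "card Q ^ card (U n) \<le> card good" by (simp add: card_funcsetE)
    then have "card Q ^ card (U n) * card Q ^ (t * card A)
        \<le> card Q ^ card B * (card Q ^ t - 1) ^ card A"
      using good_le by (meson le_trans mult_le_mono1)
    then have "real (card Q) ^ card (U n) * real (card Q ^ t) ^ card A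
        \<le> real (card Q) ^ card B * real (card Q ^ t - 1) ^ card A"
      unfolding power_mult of_nat_power[symmetric] of_nat_mult[symmetric] of_nat_le_iff .
    then have "ln (real (card Q) ^ card (U n) * real (card Q ^ t) ^ card A)
        \<le> ln (real (card Q) ^ card B * real (card Q ^ t - 1) ^ card A)"
      using card_states block by (intro ln_mono) auto
    then have "real (card (U n)) * ln (real (card Q)) + real (card A) * ln (real (card Q ^ t))
        \<le> real (card B) * ln (real (card Q)) + real (card A) * ln (real (card Q ^ t - 1))"
      using card_states block by (subst (asm) (1 2) ln_mult_pos) (simp_all add: ln_realpow del: of_nat_power)
    then have "real (card A) * \<Delta> \<le> (real (card B) - real (card (U n))) * ln (real (card Q))"
      by (simp add: \<Delta>_def algebra_simps)
    also have "\<dots> < \<Delta> / (K * ln (real (card Q))) * real (card (U n)) * ln (real (card Q))"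
      using n(2) lnq by (intro mult_strict_right_mono) (simp_all add: B_def algebra_simps)
    also have "\<dots> = \<Delta> * real (card (U n)) / K"
      using lnq by simp
    also have "\<dots> \<le> \<Delta> * (K * real (card A)) / K"
    proof -
      have "real (card (U n)) \<le> real (card (U (n + s)))"
        using card_ball_mono[of n "n + s"] by simp
      also have "\<dots> \<le> K * real (card A)"
        using card_ball_le_tiles[OF Z, of "n + s"] n(1)
        unfolding K_def A_def by (metis of_nat_le_iff of_nat_mult trans_le_add1)
      finally show ?thesis using \<Delta> K by (intro divide_right_mono mult_left_mono) auto
    qed
    also have "\<dots> = real (card A) * \<Delta>" using K by simp
    finally show False by simp
  qed
  moreover have "card (image ` (U n \<rightarrow>\<^sub>E Q)) \<le> card good"
    by (rule card_mono[OF fin_good image_good])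
  ultimately have "\<not> inj_on image (U n \<rightarrow>\<^sub>E Q)"
    by (intro pigeonhole) simp
  then obtain x y where xy: "x \<in> U n \<rightarrow>\<^sub>E Q" "y \<in> U n \<rightarrow>\<^sub>E Q" "x \<noteq> y" "image x = image y"
    by (auto simp: inj_on_def)
  show thesis
  proof (rule that)
    show "ext x \<in> C" "ext y \<in> C" using ext xy by auto
    show "ext x \<noteq> ext y"
    proof
      assume eq: "ext x = ext y"
      have "x = y"
      proof (rule PiE_ext[OF xy(1,2)])
        fix g assume "g \<in> U n"
        then show "x g = y g" using fun_cong[OF eq, of g] ball_closed by (simp add: ext_def)
      qed
      with xy(3) show False by simp
    qed
    have image_eq: "\<Phi> (ext x) g = \<Phi> (ext y) g" if g: "g \<in> carrier G" for g
    proof (cases "g \<in> B")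
      case True
      then show ?thesis using fun_cong[OF xy(4), of g] by (simp add: image_def)
    next
      case False
      have "g \<otimes> \<nu> \<notin> U n" if "\<nu> \<in> N" for \<nu>
      proof
        assume "g \<otimes> \<nu> \<in> U n"
        then have "g \<otimes> \<nu> \<otimes> inv \<nu> \<in> B"
          unfolding B_def using that s by (intro ball_mult ball_inv) auto
        then show False
          using False that g neighbourhood_subset by (auto simp: m_assoc subset_iff)
      qed
      then show ?thesis
        using g neighbourhood_subset by (intro global_map_cong) (auto simp: ext_def subset_iff)
    qed
    show "\<Phi> (ext x) = \<Phi> (ext y)"
      by (rule config_eqI[OF global_map_config[OF ext] global_map_config[OF ext] image_eq])
        (use xy in auto)
    show "finite {g \<in> carrier G. ext x g \<noteq> ext y g}"
      by (rule finite_subset[of _ "U n"]) (auto simp: ext_def)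
  qed
qed

section \<open>From one pattern to positive distance\<close>

lemma orphan_config_isolated:
  assumes "c \<in> C" "c \<notin> \<Phi> ` C"
  obtains e where "e \<in> C" "\<And>x. x \<in> C \<Longrightarrow> besicovitch_pseudodist G S (\<Phi> x) e \<noteq> 0"
proof -
  obtain R where orphan: "\<And>x. x \<in> C \<Longrightarrow> \<exists>u\<in>U R. \<Phi> x u \<noteq> c u"
    using orphan_exists[OF assms] by blast
  obtain Z where Z: "tiling R Z" by (rule tiling_exists)
  obtain q where q: "q \<in> Q" using card_states by fastforce
  obtain e where e: "e \<in> C" "\<forall>z\<in>Z. \<forall>u\<in>U R. e (z \<otimes> u) = c u"
    "\<forall>g\<in>carrier G. (\<forall>z\<in>Z. \<forall>u\<in>U R. g \<noteq> z \<otimes> u) \<longrightarrow> e g = q"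
    using paste_on_tiles[OF Z assms(1) q] by metis
  have "besicovitch_pseudodist G S (\<Phi> x) e \<noteq> 0" if x: "x \<in> C" for x
  proof (rule pseudodist_pos[OF Z])
    fix z assume z: "z \<in> Z"
    then obtain u where "u \<in> U R" "\<Phi> x (z \<otimes> u) \<noteq> c u"
      using orphan_translate[OF orphan x] tiling_subset[OF Z] by blast
    then show "\<exists>u\<in>U R. \<Phi> x (z \<otimes> u) \<noteq> e (z \<otimes> u)"
      using e(2) z by auto
  qed
  with e(1) show thesis by (rule that)
qed

text \<open>The pasted blocks carry, besides the cells where \<open>c1\<close> and \<open>c2\<close> disagree, a collar of width
  \<open>2 s\<close>: a cell whose neighbourhood meets the disagreement then has its whole neighbourhood inside
  one block and cannot tell the pasted configuration from \<open>c1\<close> or \<open>c2\<close>.\<close>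

lemma erasable_pair_dense:
  assumes c: "c1 \<in> C" "c2 \<in> C" "c1 \<noteq> c2" "\<Phi> c1 = \<Phi> c2"
    and fin: "finite {g \<in> carrier G. c1 g \<noteq> c2 g}"
  obtains e1 e2 where "e1 \<in> C" "e2 \<in> C" "\<Phi> e1 = \<Phi> e2" "besicovitch_pseudodist G S e1 e2 \<noteq> 0"
proof -
  obtain s where s: "N \<subseteq> U s" by (rule neighbourhood_radius)
  obtain q where q: "q \<in> Q" using card_states by fastforce
  have "{g \<in> carrier G. c1 g \<noteq> c2 g} \<subseteq> carrier G" by blast
  from finite_subset_ball[OF fin this]
  obtain n where n: "{g \<in> carrier G. c1 g \<noteq> c2 g} \<subseteq> U n" .
  define R where "R = n + s + s"
  obtain Z where Z: "tiling R Z" by (rule tiling_exists)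
  obtain e1 where e1: "e1 \<in> C" "\<forall>z\<in>Z. \<forall>u\<in>U R. e1 (z \<otimes> u) = c1 u"
    "\<forall>g\<in>carrier G. (\<forall>z\<in>Z. \<forall>u\<in>U R. g \<noteq> z \<otimes> u) \<longrightarrow> e1 g = q"
    using paste_on_tiles[OF Z c(1) q] by metis
  obtain e2 where e2: "e2 \<in> C" "\<forall>z\<in>Z. \<forall>u\<in>U R. e2 (z \<otimes> u) = c2 u"
    "\<forall>g\<in>carrier G. (\<forall>z\<in>Z. \<forall>u\<in>U R. g \<noteq> z \<otimes> u) \<longrightarrow> e2 g = q"
    using paste_on_tiles[OF Z c(2) q] by metis
  have agree: "e1 h = e2 h"
    if h: "h \<in> carrier G" "\<And>z u. z \<in> Z \<Longrightarrow> u \<in> U n \<Longrightarrow> h \<noteq> z \<otimes> u" for h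
  proof (cases "\<exists>z\<in>Z. \<exists>u\<in>U R. h = z \<otimes> u")
    case True
    then obtain z u where zu: "z \<in> Z" "u \<in> U R" "h = z \<otimes> u" by blast
    then have "c1 u = c2 u" using h(2) n ball_closed by blast
    then show ?thesis using zu e1(2) e2(2) by simp
  next
    case False
    then show ?thesis using e1(3) e2(3) h(1) by simp
  qed
  have "\<Phi> e1 g = \<Phi> e2 g" if g: "g \<in> carrier G" for g
  proof (cases "\<exists>\<nu>\<in>N. \<exists>z\<in>Z. \<exists>u\<in>U n. g \<otimes> \<nu> = z \<otimes> u")
    case True
    then obtain \<nu> z u where v: "\<nu> \<in> N" "z \<in> Z" "u \<in> U n" "g \<otimes> \<nu> = z \<otimes> u" by blast
    have closed: "\<nu> \<in> carrier G" "z \<in> carrier G" "u \<in> carrier G"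
      using v neighbourhood_subset tiling_subset[OF Z] ball_closed by auto
    define w where "w = u \<otimes> inv \<nu>"
    have w: "w \<in> U (n + s)"
      unfolding w_def using v s by (intro ball_mult ball_inv) auto
    have g_eq: "g = z \<otimes> w"
      using v(4) closed g by (metis inv_closed inv_solve_right m_assoc m_closed w_def)
    have cell: "g \<otimes> \<nu>' = z \<otimes> (w \<otimes> \<nu>')" "w \<otimes> \<nu>' \<in> U R" if "\<nu>' \<in> N" for \<nu>'
    proof -
      show "w \<otimes> \<nu>' \<in> U R"
        unfolding R_def using w that s by (intro ball_mult) auto
      show "g \<otimes> \<nu>' = z \<otimes> (w \<otimes> \<nu>')"
        using g_eq closed ball_closed[OF w] that neighbourhood_subset by (auto simp: m_assoc)
    qed
    have "\<Phi> e1 g = \<Phi> c1 w"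
      using cell e1(2) v(2) by (intro global_map_cong g ball_closed[OF w]) simp
    also have "\<dots> = \<Phi> c2 w" using c(4) by simp
    also have "\<dots> = \<Phi> e2 g"
      using cell e2(2) v(2) by (intro global_map_cong g ball_closed[OF w]) simp
    finally show ?thesis .
  next
    case False
    show ?thesis
      by (intro global_map_cong g agree) (use False g neighbourhood_subset in auto)
  qed
  then have "\<Phi> e1 = \<Phi> e2"
    by (rule config_eqI[OF global_map_config[OF e1(1)] global_map_config[OF e2(1)]])
  moreover have "besicovitch_pseudodist G S e1 e2 \<noteq> 0"
  proof (rule pseudodist_pos[OF Z])
    fix z assume z: "z \<in> Z"
    obtain u where u: "u \<in> carrier G" "c1 u \<noteq> c2 u"
      using c(3) config_eqI[OF c(1,2)] by blast
    moreover have "u \<in> U R" using u n ball_mono[of n R] by (auto simp: R_def)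
    ultimately show "\<exists>u\<in>U R. e1 (z \<otimes> u) \<noteq> e2 (z \<otimes> u)"
      using e1(2) e2(2) z by auto
  qed
  ultimately show thesis using that e1(1) e2(1) by blast
qed

end

section \<open>The induced map on the Besicovitch space\<close>

lemma (in group_with_generators) pseudodist_le_mult:
  assumes "L \<ge> 0"
    and "\<And>n. difference_density G S d1 d2 n \<le> L * difference_density G S c1 c2 (n + r)"
  shows "besicovitch_pseudodist G S d1 d2 \<le> L * besicovitch_pseudodist G S c1 c2"
proof -
  let ?u = "\<lambda>n. ereal (difference_density G S c1 c2 n)"
  have "ereal (besicovitch_pseudodist G S d1 d2) \<le> limsup (\<lambda>n. ereal L * ?u (n + r))"
    unfolding ereal_besicovitch_pseudodist[OF finite_generators]
    by (rule Limsup_mono) (simp add: assms(2))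
  also have "\<dots> = ereal L * limsup (\<lambda>n. ?u (n + r))"
    using assms(1) by (intro Limsup_ereal_mult_left) simp_all
  also have "limsup (\<lambda>n. ?u (n + r)) = limsup ?u"
    by (rule limsup_shift_k)
  also have "ereal L * \<dots> = ereal (L * besicovitch_pseudodist G S c1 c2)"
    by (simp flip: ereal_besicovitch_pseudodist[OF finite_generators])
  finally show ?thesis by simp
qed

lemma (in group_with_generators) class_in_space:
  "c \<in> configs G Q \<Longrightarrow> besicovitch_class G S Q c \<in> besicovitch_space G S Q"
  by (simp add: besicovitch_class_def besicovitch_space_def quotientI)

lemma (in group_with_generators) space_cases:
  assumes "x \<in> besicovitch_space G S Q"
  obtains c where "c \<in> configs G Q" "x = besicovitch_class G S Q c"
  using assms by (auto simp: besicovitch_class_def besicovitch_space_def elim!: quotientE)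

lemma (in group_with_generators) class_self:
  "c \<in> configs G Q \<Longrightarrow> c \<in> besicovitch_class G S Q c"
  unfolding besicovitch_class_def
  by (rule equiv_class_self[OF equiv_besicovitch_rel[OF finite_generators]])

lemma (in group_with_generators) class_eq_iff:
  assumes "c \<in> configs G Q" "d \<in> configs G Q"
  shows "besicovitch_class G S Q c = besicovitch_class G S Q d \<longleftrightarrow>
    besicovitch_pseudodist G S c d = 0"
  using eq_equiv_class_iff[OF equiv_besicovitch_rel[OF finite_generators] assms] assms
  by (simp add: besicovitch_class_def besicovitch_rel_def
      besicovitch_pseudodist_eq_0_iff[OF finite_generators])

lemma (in group_with_generators) dist_class:
  assumes "c \<in> configs G Q" "d \<in> configs G Q"
  shows "besicovitch_dist G S (besicovitch_class G S Q c) (besicovitch_class G S Q d)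
    = besicovitch_pseudodist G S c d"
  by (rule besicovitch_dist_eq[OF finite_generators])
    (use assms class_in_space class_self in auto)

context automaton_with_generators
begin

text \<open>A cell whose new states differ sees a difference at one of the \<open>|N|\<close> neighbours, and this
  difference lies in a ball that is larger by a bounded factor.\<close>

lemma difference_density_global_map:
  assumes r: "N \<subseteq> U r"
  shows "difference_density G S (\<Phi> c1) (\<Phi> c2) n
    \<le> real (card N * card (U r)) * difference_density G S c1 c2 (n + r)"
proof -
  let ?D = "{g \<in> U (n + r). c1 g \<noteq> c2 g}"
  let ?E = "\<lambda>\<nu>. {g \<in> U n. c1 (g \<otimes> \<nu>) \<noteq> c2 (g \<otimes> \<nu>)}"
  have E: "card (?E \<nu>) \<le> card ?D" if "\<nu> \<in> N" for \<nu>
  proof (rule card_inj_on_le)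
    show "inj_on (\<lambda>g. g \<otimes> \<nu>) (?E \<nu>)"
      by (rule inj_onI) (use that neighbourhood_subset ball_closed in auto)
    show "(\<lambda>g. g \<otimes> \<nu>) ` ?E \<nu> \<subseteq> ?D"
      using that r ball_mult[of _ n \<nu> r] by auto
  qed simp
  have "{g \<in> U n. \<Phi> c1 g \<noteq> \<Phi> c2 g} \<subseteq> (\<Union>\<nu>\<in>N. ?E \<nu>)"
  proof
    fix g assume g: "g \<in> {g \<in> U n. \<Phi> c1 g \<noteq> \<Phi> c2 g}"
    have "\<exists>\<nu>\<in>N. c1 (g \<otimes> \<nu>) \<noteq> c2 (g \<otimes> \<nu>)"
    proof (rule ccontr)
      assume "\<not> ?thesis"
      then have "\<Phi> c1 g = \<Phi> c2 g"
        using g ball_closed by (intro global_map_cong) auto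
      then show False using g by simp
    qed
    then show "g \<in> (\<Union>\<nu>\<in>N. ?E \<nu>)" using g by blast
  qed
  then have "card {g \<in> U n. \<Phi> c1 g \<noteq> \<Phi> c2 g} \<le> card (\<Union>\<nu>\<in>N. ?E \<nu>)"
    by (rule card_mono[rotated]) (simp add: finite_neighbourhood)
  also have "\<dots> \<le> (\<Sum>\<nu>\<in>N. card (?E \<nu>))"
    by (rule card_UN_le[OF finite_neighbourhood])
  also have "\<dots> \<le> card N * card ?D"
    using sum_bounded_above[of N "\<lambda>\<nu>. card (?E \<nu>)" "card ?D"] E by simp
  finally have num: "real (card {g \<in> U n. \<Phi> c1 g \<noteq> \<Phi> c2 g}) \<le> real (card N * card ?D)"
    by (simp only: of_nat_le_iff)
  have ball: "real (card (U (n + r))) \<le> real (card (U n)) * real (card (U r))"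
    unfolding of_nat_mult[symmetric] of_nat_le_iff by (rule card_ball_add)
  have pos: "real (card (U n)) > 0" "real (card (U (n + r))) > 0"
    using card_ball_pos by simp_all
  have "real (card {g \<in> U n. \<Phi> c1 g \<noteq> \<Phi> c2 g}) * real (card (U (n + r)))
      \<le> real (card N * card ?D) * (real (card (U n)) * real (card (U r)))"
    by (rule mult_mono[OF num ball]) simp_all
  then show ?thesis
    using pos by (simp add: difference_density_def divide_simps mult_ac)
qed

lemma pseudodist_global_map_le:
  obtains L where "L > 0"
    "\<And>c1 c2. besicovitch_pseudodist G S (\<Phi> c1) (\<Phi> c2) \<le> L * besicovitch_pseudodist G S c1 c2"
proof -
  obtain r where r: "N \<subseteq> U r" by (rule neighbourhood_radius)
  define L where "L = real (card N * card (U r))"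
  show thesis
  proof (rule that)
    show "L > 0"
      using finite_neighbourhood neighbourhood_nonempty card_ball_pos
      by (simp add: L_def card_gt_0_iff)
    show "besicovitch_pseudodist G S (\<Phi> c1) (\<Phi> c2) \<le> L * besicovitch_pseudodist G S c1 c2"
      for c1 c2
      unfolding L_def
      by (rule pseudodist_le_mult[OF _ difference_density_global_map[OF r]]) simp
  qed
qed

text \<open>Subexponential growth is known for some generating set \<open>T\<close> only. The Garden of Eden theorem
  is applied with that one; its conclusion does not mention balls any more.\<close>

lemma not_surjective_collision:
  assumes "subexponential_growth G" and not_surj: "c \<in> C" "c \<notin> \<Phi> ` C"
  obtains e1 e2 where "e1 \<in> C" "e2 \<in> C" "\<Phi> e1 = \<Phi> e2" "besicovitch_pseudodist G S e1 e2 \<noteq> 0"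
proof -
  obtain T where T: "finite_generating_set G T"
    and sub: "\<And>l::real. l > 1 \<Longrightarrow> \<exists>n0. \<forall>n\<ge>n0. real (card (word_ball G T n)) \<le> l ^ n"
    using assms(1) unfolding subexponential_growth_def growth_def by blast
  interpret T: automaton_with_generators G T Q N f
    by unfold_locales (rule T)
  obtain c1 c2 where "c1 \<in> C" "c2 \<in> C" "c1 \<noteq> c2" "\<Phi> c1 = \<Phi> c2"
    "finite {g \<in> carrier G. c1 g \<noteq> c2 g}"
    by (rule T.erasable_pair_exists[OF sub not_surj])
  from erasable_pair_dense[OF this] show thesis using that .
qed

definition induced_map :: "('a \<Rightarrow> 'c) set \<Rightarrow> ('a \<Rightarrow> 'c) set" where
  "induced_map = (\<lambda>x\<in>besicovitch_space G S Q. besicovitch_class G S Q (\<Phi> (SOME c. c \<in> x)))"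

lemma induced_map_class:
  assumes c: "c \<in> C"
  shows "induced_map (besicovitch_class G S Q c) = besicovitch_class G S Q (\<Phi> c)"
proof -
  define d where "d = (SOME d. d \<in> besicovitch_class G S Q c)"
  have "d \<in> besicovitch_class G S Q c"
    unfolding d_def by (rule someI[of "\<lambda>d. d \<in> _"]) (rule class_self[OF c])
  then have d: "d \<in> C" "besicovitch_pseudodist G S d c = 0"
    by (auto simp: besicovitch_class_def besicovitch_rel_def difference_density_commute
        besicovitch_pseudodist_eq_0_iff[OF finite_generators])
  obtain L where
    "\<And>c1 c2. besicovitch_pseudodist G S (\<Phi> c1) (\<Phi> c2) \<le> L * besicovitch_pseudodist G S c1 c2"
    using pseudodist_global_map_le by metis
  from this[of d c] have "besicovitch_pseudodist G S (\<Phi> d) (\<Phi> c) = 0"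
    using d(2) besicovitch_pseudodist_nonneg[of G S "\<Phi> d" "\<Phi> c"] by simp
  then have "besicovitch_class G S Q (\<Phi> d) = besicovitch_class G S Q (\<Phi> c)"
    using class_eq_iff global_map_config c d(1) by blast
  then show ?thesis
    using class_in_space[OF c] by (simp add: induced_map_def d_def)
qed

lemma induced_map_closed: "induced_map \<in> besicovitch_space G S Q \<rightarrow>\<^sub>E besicovitch_space G S Q"
proof (rule PiE_I)
  fix x assume "x \<in> besicovitch_space G S Q"
  then show "induced_map x \<in> besicovitch_space G S Q"
    by (elim space_cases) (simp add: induced_map_class class_in_space global_map_config)
qed (simp add: induced_map_def)

lemma induced_map_lipschitz:
  obtains L where "L > 0"
    "\<forall>x1\<in>besicovitch_space G S Q. \<forall>x2\<in>besicovitch_space G S Q.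
      besicovitch_dist G S (induced_map x1) (induced_map x2) \<le> L * besicovitch_dist G S x1 x2"
proof -
  obtain L where L: "L > 0"
    "\<And>c1 c2. besicovitch_pseudodist G S (\<Phi> c1) (\<Phi> c2) \<le> L * besicovitch_pseudodist G S c1 c2"
    using pseudodist_global_map_le by metis
  show thesis
  proof (rule that[OF L(1)], intro ballI)
    fix x1 x2 assume "x1 \<in> besicovitch_space G S Q" "x2 \<in> besicovitch_space G S Q"
    then show "besicovitch_dist G S (induced_map x1) (induced_map x2)
        \<le> L * besicovitch_dist G S x1 x2"
      by (elim space_cases) (simp add: induced_map_class dist_class global_map_config L(2))
  qed
qed

lemma induced_map_surjective_iff:
  "induced_map ` besicovitch_space G S Q = besicovitch_space G S Q \<longleftrightarrow> \<Phi> ` C = C"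
proof
  assume surj: "induced_map ` besicovitch_space G S Q = besicovitch_space G S Q"
  have "c \<in> \<Phi> ` C" if c: "c \<in> C" for c
  proof (rule ccontr)
    assume "c \<notin> \<Phi> ` C"
    then obtain e where e: "e \<in> C" "\<And>x. x \<in> C \<Longrightarrow> besicovitch_pseudodist G S (\<Phi> x) e \<noteq> 0"
      using orphan_config_isolated[OF c] by metis
    obtain y where y: "y \<in> besicovitch_space G S Q" "induced_map y = besicovitch_class G S Q e"
      using surj class_in_space[OF e(1)] by (metis imageE)
    obtain x where "x \<in> C" "y = besicovitch_class G S Q x"
      using y(1) by (rule space_cases)
    then show False
      using y(2) e class_eq_iff[OF global_map_config e(1)] induced_map_class by metis
  qed
  then show "\<Phi> ` C = C" using global_map_config by blast
next
  assume surj: "\<Phi> ` C = C"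
  have "x \<in> induced_map ` besicovitch_space G S Q" if x: "x \<in> besicovitch_space G S Q" for x
  proof -
    obtain d where d: "d \<in> C" "x = besicovitch_class G S Q d" using x by (rule space_cases)
    then obtain c where "c \<in> C" "d = \<Phi> c" using surj by blast
    then have "x = induced_map (besicovitch_class G S Q c)"
      using d induced_map_class by simp
    then show ?thesis using class_in_space[OF \<open>c \<in> C\<close>] by blast
  qed
  then show "induced_map ` besicovitch_space G S Q = besicovitch_space G S Q"
    using induced_map_closed by auto
qed

lemma induced_map_injective_iff:
  assumes "subexponential_growth G"
  shows "inj_on induced_map (besicovitch_space G S Q) \<longleftrightarrow>
    bij_betw induced_map (besicovitch_space G S Q) (besicovitch_space G S Q)"
proof
  assume inj: "inj_on induced_map (besicovitch_space G S Q)"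
  have "\<Phi> ` C = C"
  proof (rule ccontr)
    assume "\<Phi> ` C \<noteq> C"
    then obtain c where c: "c \<in> C" "c \<notin> \<Phi> ` C" using global_map_config by blast
    obtain e1 e2 where e: "e1 \<in> C" "e2 \<in> C" "\<Phi> e1 = \<Phi> e2" "besicovitch_pseudodist G S e1 e2 \<noteq> 0"
      by (rule not_surjective_collision[OF assms c])
    have "induced_map (besicovitch_class G S Q e1) = induced_map (besicovitch_class G S Q e2)"
      using e by (simp add: induced_map_class)
    then have "besicovitch_class G S Q e1 = besicovitch_class G S Q e2"
      by (rule inj_onD[OF inj]) (use e class_in_space in auto)
    with e show False by (simp add: class_eq_iff)
  qed
  with inj show "bij_betw induced_map (besicovitch_space G S Q) (besicovitch_space G S Q)"
    by (simp add: bij_betw_def induced_map_surjective_iff)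
qed (simp add: bij_betw_def)

end

section \<open>Polynomial growth\<close>

text \<open>For \<open>S = T\<close> this is a doubling condition, and for two generating sets it shows that their
  difference densities are comparable. Polynomial growth is given for a third set \<open>P\<close>, whose balls
  are nested between those of \<open>S\<close> and \<open>T\<close> up to constant factors in the radius.\<close>

lemma polynomial_ball_comparison:
  assumes poly: "polynomial_growth G"
    and S: "group_with_generators G S" and T: "group_with_generators G T"
    and M: "M \<ge> 1"
  obtains K :: real and n1 where "K > 0"
    "\<And>n. n \<ge> n1 \<Longrightarrow> real (card (word_ball G S (M * n))) \<le> K * real (card (word_ball G T n))"
proof -
  interpret S: group_with_generators G S by (rule S)
  interpret T: group_with_generators G T by (rule T)
  obtain P k n0 and C1 C2 :: real where P: "finite_generating_set G P" and C: "C1 > 0" "C2 > 0"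
    and bounds: "\<And>n. n \<ge> n0 \<Longrightarrow> C1 * real n ^ k \<le> real (growth G P n)"
      "\<And>n. n \<ge> n0 \<Longrightarrow> real (growth G P n) \<le> C2 * real n ^ k"
    using poly unfolding polynomial_growth_def by blast
  interpret P: group_with_generators G P by unfold_locales (rule P)
  obtain a where a: "a \<ge> 1" "\<And>n. word_ball G P n \<subseteq> word_ball G T (a * n)"
    using T.ball_change_generators[OF P.group_with_generators_axioms] by metis
  obtain b where b: "b \<ge> 1" "\<And>n. word_ball G S n \<subseteq> word_ball G P (b * n)"
    using P.ball_change_generators[OF S] by metis
  define D where "D = 2 * a * b * M"
  have bM: "1 \<le> b * M" using b(1) M by simp
  have "real (card (word_ball G S (M * n))) \<le> C2 * real D ^ k / C1 * real (card (word_ball G T n))"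
    if n: "n \<ge> a * Suc n0" for n
  proof -
    \<comment> \<open>The ball of radius \<open>m\<close> for the reference generators fits into the ball of radius \<open>n\<close>, and
      \<open>n\<close> is at most \<open>2 * a * m\<close>.\<close>
    define m where "m = n div a"
    have m: "Suc n0 \<le> m"
      using div_le_mono[OF n, of a] a(1) by (simp add: m_def)
    have "n < a * Suc m"
      using a(1) dividend_less_times_div[of a n] by (simp add: m_def)
    also have "\<dots> \<le> 2 * a * m" using m by (cases m) auto
    finally have "b * M * n \<le> b * M * (2 * a * m)"
      by (intro mult_le_mono2) simp
    then have "b * M * n \<le> D * m" by (simp add: D_def mult_ac)
    then have Dm: "real (b * M * n) \<le> real D * real m"
      by (simp only: of_nat_mult[symmetric] of_nat_le_iff)
    have "n0 \<le> m" using m by simp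
    also have "m \<le> n" by (simp add: m_def)
    also have "n \<le> b * M * n" using bM by (cases "b * M") auto
    finally have n0: "n0 \<le> b * M * n" .
    have "card (word_ball G S (M * n)) \<le> growth G P (b * M * n)"
      unfolding growth_def mult.assoc by (rule card_mono[OF P.finite_ball b(2)])
    then have "real (card (word_ball G S (M * n))) \<le> real (growth G P (b * M * n))"
      by simp
    also have "\<dots> \<le> C2 * real (b * M * n) ^ k"
      by (rule bounds(2)[OF n0])
    also have "\<dots> \<le> C2 * (real D * real m) ^ k"
      using C Dm by (intro mult_left_mono power_mono) auto
    also have "\<dots> = C2 * real D ^ k / C1 * (C1 * real m ^ k)"
      using C by (simp add: power_mult_distrib)
    also have "\<dots> \<le> C2 * real D ^ k / C1 * real (card (word_ball G T n))"
    proof (rule mult_left_mono)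
      have "growth G P m \<le> card (word_ball G T n)"
        unfolding growth_def
      proof (rule card_mono[OF T.finite_ball])
        have "a * m \<le> n" by (simp add: m_def)
        then show "word_ball G P m \<subseteq> word_ball G T n"
          using a(2)[of m] T.ball_mono by blast
      qed
      then show "C1 * real m ^ k \<le> real (card (word_ball G T n))"
        using bounds(1)[of m] m by linarith
    qed (use C in simp)
    finally show ?thesis .
  qed
  moreover have "C2 * real D ^ k / C1 > 0"
    using C a(1) b(1) M by (simp add: D_def)
  ultimately show thesis using that by blast
qed

context group_with_generators
begin

text \<open>Every point \<open>x\<close> of the shell between the radii \<open>n - w\<close> and \<open>n\<close> is within distance \<open>2 w\<close> of some
  \<open>y\<close>, obtained by cutting off the end of a word for \<open>x\<close>, such that the ball of radius \<open>w\<close> around \<open>y\<close>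
  lies in the adjacent shell between \<open>n - 4 w\<close> and \<open>n - w\<close>. Conversely a point of the adjacent shell arises in this way from at
  most \<open>|U\<^bsub>3w\<^esub>|\<close> points \<open>x\<close>. Double counting the pairs shows that the outer shell is not large
  compared with the adjacent one.\<close>

lemma card_shell_le:
  assumes w: "4 * w \<le> n"
  shows "card (U n - U (n - w)) * card (U w) \<le> card (U (n - w) - U (n - 4 * w)) * card (U (3 * w))"
proof -
  let ?A = "U n - U (n - w)" and ?B = "U (n - w) - U (n - 4 * w)"
  have "\<exists>y. y \<in> U (n - 2 * w) \<and> (\<exists>u\<in>U (2 * w). x = y \<otimes> u)" if x: "x \<in> ?A" for x
  proof -
    have "x \<in> U ((n - 2 * w) + 2 * w)" using x w by simp
    then obtain y u where "y \<in> U (n - 2 * w)" "u \<in> U (2 * w)" "x = y \<otimes> u"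
      by (rule ball_split)
    then show ?thesis by blast
  qed
  then obtain Y where Y: "\<And>x. x \<in> ?A \<Longrightarrow> Y x \<in> U (n - 2 * w)"
    "\<And>x. x \<in> ?A \<Longrightarrow> \<exists>u\<in>U (2 * w). x = Y x \<otimes> u"
    by metis
  \<comment> \<open>The second component is the displacement from \<open>x\<close> to the point in the first, so that the pair
    determines \<open>x\<close>.\<close>
  let ?F = "\<lambda>(x, v). (Y x \<otimes> v, inv x \<otimes> (Y x \<otimes> v))"
  have "inj_on ?F (?A \<times> U w)"
  proof (rule inj_onI, clarify)
    fix x v x' v'
    assume x: "x \<in> U n" "x \<notin> U (n - w)" and x': "x' \<in> U n" "x' \<notin> U (n - w)"
      and v: "v \<in> U w" "v' \<in> U w"
      and eq: "Y x \<otimes> v = Y x' \<otimes> v'" "inv x \<otimes> (Y x \<otimes> v) = inv x' \<otimes> (Y x' \<otimes> v')"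
    have closed: "x \<in> carrier G" "x' \<in> carrier G" "v \<in> carrier G" "v' \<in> carrier G"
      "Y x \<in> carrier G" "Y x' \<in> carrier G"
      using x x' v Y(1) ball_closed by blast+
    have "inv x = inv x'"
      using eq closed by (metis inv_closed m_closed right_cancel)
    then have "x = x'" using closed inv_inv by metis
    then show "x = x' \<and> v = v'" using eq(1) closed by simp
  qed
  moreover have "?F ` (?A \<times> U w) \<subseteq> ?B \<times> U (3 * w)"
  proof (rule image_subsetI)
    fix p assume "p \<in> ?A \<times> U w"
    then obtain x v where p: "p = (x, v)" and x: "x \<in> U n" "x \<notin> U (n - w)" and v: "v \<in> U w"
      by blast
    obtain u where u: "u \<in> U (2 * w)" "x = Y x \<otimes> u" using Y(2)[of x] x by blast
    have y: "Y x \<in> U (n - 2 * w)" using Y(1)[of x] x by blast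
    have closed: "Y x \<in> carrier G" "u \<in> carrier G" "v \<in> carrier G"
      using y u v ball_closed by auto
    have "Y x \<otimes> v \<in> U (n - 2 * w + w)" by (rule ball_mult[OF y v])
    then have in_B: "Y x \<otimes> v \<in> U (n - w)" using w by simp
    have not_inner: "Y x \<otimes> v \<notin> U (n - 4 * w)"
    proof
      assume "Y x \<otimes> v \<in> U (n - 4 * w)"
      then have "Y x \<otimes> v \<otimes> inv v \<otimes> u \<in> U (n - 4 * w + w + 2 * w)"
        by (intro ball_mult ball_inv v u)
      then have "x \<in> U (n - w)" using closed u(2) w by (simp add: m_assoc)
      then show False using x(2) by blast
    qed
    have "inv x \<otimes> (Y x \<otimes> v) = inv u \<otimes> v"
    proof -
      have "inv x = inv u \<otimes> inv (Y x)"
        using arg_cong[OF u(2), of "\<lambda>g. inv g"] closed by (simp add: inv_mult_group)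
      then show ?thesis
        using closed by (simp add: m_assoc) (simp add: m_assoc[symmetric])
    qed
    also have "\<dots> \<in> U (2 * w + w)" by (intro ball_mult ball_inv u v)
    finally show "?F p \<in> ?B \<times> U (3 * w)"
      using in_B not_inner p by simp
  qed
  ultimately have "card (?A \<times> U w) \<le> card (?B \<times> U (3 * w))"
    by (rule card_inj_on_le) simp
  then show ?thesis by (simp add: card_cartesian_product)
qed

lemma card_shell_widen:
  assumes doubling: "real (card (U (3 * w))) \<le> K * real (card (U w))" and w: "4 * w \<le> n"
    and K: "K > 0"
  shows "real (card (U n - U (n - w))) \<le> K / (K + 1) * real (card (U n - U (n - 4 * w)))"
proof -
  let ?A = "U n - U (n - w)" and ?B = "U (n - w) - U (n - 4 * w)"
  have pos: "real (card (U w)) > 0" using card_ball_pos by simp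
  have "real (card ?A) * real (card (U w)) \<le> real (card ?B) * real (card (U (3 * w)))"
    unfolding of_nat_mult[symmetric] of_nat_le_iff by (rule card_shell_le[OF w])
  also have "\<dots> \<le> real (card ?B) * (K * real (card (U w)))"
    by (rule mult_left_mono[OF doubling]) simp
  finally have "real (card ?A) * real (card (U w)) \<le> K * real (card ?B) * real (card (U w))"
    by (simp add: mult_ac)
  then have AB: "real (card ?A) \<le> K * real (card ?B)"
    by (rule mult_right_le_imp_le[OF _ pos])
  have "U n - U (n - 4 * w) = ?A \<union> ?B"
    using ball_mono[of "n - 4 * w" "n - w"] ball_mono[of "n - w" n] by fastforce
  then have "card (U n - U (n - 4 * w)) = card ?A + card ?B"
    by (simp only:) (rule card_Un_disjoint, auto)
  then have "(K + 1) * real (card ?A) \<le> K * real (card (U n - U (n - 4 * w)))"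
    using AB by (simp add: algebra_simps)
  then show ?thesis using K by (simp add: field_simps)
qed

text \<open>Widening the shell by a factor four multiplies its size by a definite factor, so a thin shell
  is an arbitrarily small part of a large ball.\<close>

lemma shell_ratio_tendsto_0:
  assumes K: "K > 0"
    and doubling: "\<And>w. w \<ge> w0 \<Longrightarrow> real (card (U (3 * w))) \<le> K * real (card (U w))"
  shows "(\<lambda>n. real (card (U n - U (n - r))) / real (card (U n))) \<longlonglongrightarrow> 0"
proof (rule LIMSEQ_I)
  fix e :: real assume e: "0 < e"
  define \<theta> where "\<theta> = K / (K + 1)"
  have \<theta>: "0 < \<theta>" "\<theta> < 1" using K by (simp_all add: \<theta>_def)
  obtain j where j: "\<theta> ^ j < e" using real_arch_pow_inv[OF e \<theta>(2)] by blast
  define w where "w = max r w0"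
  have shrink: "real (card (U n - U (n - v))) \<le> \<theta> ^ i * real (card (U n))"
    if "w0 \<le> v" "4 ^ i * v \<le> n" for n v i
    using that
  proof (induction i arbitrary: v)
    case 0
    show ?case by (simp add: card_mono)
  next
    case (Suc i)
    have "4 * v \<le> 4 ^ Suc i * v" by simp
    then have "4 * v \<le> n" using Suc.prems(2) by (rule le_trans)
    then have "real (card (U n - U (n - v))) \<le> \<theta> * real (card (U n - U (n - 4 * v)))"
      unfolding \<theta>_def by (intro card_shell_widen doubling Suc.prems K)
    also have "\<dots> \<le> \<theta> * (\<theta> ^ i * real (card (U n)))"
      using \<theta> Suc.prems by (intro mult_left_mono Suc.IH) (auto simp: mult_ac)
    finally show ?case by simp
  qed
  have "norm (real (card (U n - U (n - r))) / real (card (U n)) - 0) < e"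
    if n: "n \<ge> 4 ^ j * w" for n
  proof -
    have "card (U n - U (n - r)) \<le> card (U n - U (n - w))"
      using ball_mono[of "n - w" "n - r"] by (intro card_mono Diff_mono) (simp_all add: w_def)
    then have "real (card (U n - U (n - r))) \<le> \<theta> ^ j * real (card (U n))"
      using shrink[of w j n] n by (simp add: w_def)
    also have "\<dots> < e * real (card (U n))"
      using j card_ball_pos by simp
    finally show ?thesis using card_ball_pos[of n] by (simp add: divide_simps)
  qed
  then show "\<exists>n0. \<forall>n\<ge>n0. norm (real (card (U n - U (n - r))) / real (card (U n)) - 0) < e"
    by blast
qed

lemma ball_ratio_tendsto_1:
  assumes "polynomial_growth G"
  shows "(\<lambda>n. real (card (U (n + r))) / real (card (U n))) \<longlonglongrightarrow> 1"
proof -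
  obtain K w0 where K: "K > 0" "\<And>w. w \<ge> w0 \<Longrightarrow> real (card (U (3 * w))) \<le> K * real (card (U w))"
    using polynomial_ball_comparison[OF assms group_with_generators_axioms
        group_with_generators_axioms, of 3] by (metis one_le_numeral)
  let ?s = "\<lambda>n. real (card (U n - U (n - r))) / real (card (U n))"
  have "(\<lambda>n. ?s (n + r)) \<longlonglongrightarrow> 0"
    by (rule LIMSEQ_ignore_initial_segment[OF shell_ratio_tendsto_0[OF K]])
  then have "(\<lambda>n. inverse (1 - ?s (n + r))) \<longlonglongrightarrow> inverse (1 - 0)"
    by (intro tendsto_intros) auto
  moreover have "inverse (1 - ?s (n + r)) = real (card (U (n + r))) / real (card (U n))" for n
  proof -
    have "card (U (n + r) - U n) + card (U n) = card (U (n + r))"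
      using card_Diff_subset[of "U n" "U (n + r)"] ball_mono[of n "n + r"]
        card_ball_mono[of n "n + r"] by simp
    then have "real (card (U (n + r) - U n)) = real (card (U (n + r))) - real (card (U n))"
      by linarith
    moreover have "U (n + r) \<noteq> {}" using one_in_ball[of "n + r"] by blast
    ultimately have "1 - ?s (n + r) = real (card (U n)) / real (card (U (n + r)))"
      by (simp add: diff_divide_distrib)
    then show ?thesis by simp
  qed
  ultimately show ?thesis by simp
qed

text \<open>The error term is additive so that the limit superior of a sum can be used; the density being at
  most 1 turns the factor \<open>|U\<^bsub>n+r\<^esub>| / |U\<^sub>n|\<close> into such a term.\<close>

lemma difference_density_translate:
  assumes g: "g \<in> U r"
  shows "difference_density G S (translate G c1 g) (translate G c2 g) n
    \<le> difference_density G S c1 c2 (n + r) + (real (card (U (n + r))) / real (card (U n)) - 1)"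
proof -
  let ?D = "{h \<in> U (n + r). c1 h \<noteq> c2 h}"
  let ?d = "difference_density G S c1 c2 (n + r)"
  let ?q = "real (card (U (n + r))) / real (card (U n))"
  have "card {h \<in> U n. translate G c1 g h \<noteq> translate G c2 g h} \<le> card ?D"
  proof (rule card_inj_on_le)
    show "inj_on (\<lambda>h. g \<otimes> h) {h \<in> U n. translate G c1 g h \<noteq> translate G c2 g h}"
      by (rule inj_onI) (use g ball_closed in auto)
    show "(\<lambda>h. g \<otimes> h) ` {h \<in> U n. translate G c1 g h \<noteq> translate G c2 g h} \<subseteq> ?D"
      using ball_mult[OF g, of _ n] ball_closed by (auto simp: translate_def add.commute)
  qed simp
  then have "difference_density G S (translate G c1 g) (translate G c2 g) n
      \<le> real (card ?D) / real (card (U n))"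
    unfolding difference_density_def by (intro divide_right_mono) simp_all
  also have "\<dots> = ?d * ?q"
    using card_ball_pos[of "n + r"] by (simp add: difference_density_def)
  also have "\<dots> = ?d + ?d * (?q - 1)"
    by (simp add: algebra_simps)
  also have "\<dots> \<le> ?d + 1 * (?q - 1)"
  proof (intro add_left_mono mult_right_mono)
    show "?d \<le> 1" by (rule difference_density_le_1[OF finite_generators])
    show "0 \<le> ?q - 1"
      using card_ball_mono[of n "n + r"] card_ball_pos[of n] by simp
  qed
  finally show ?thesis by simp
qed

lemma pseudodist_translate_le:
  assumes poly: "polynomial_growth G" and g: "g \<in> carrier G"
  shows "besicovitch_pseudodist G S (translate G c1 g) (translate G c2 g)
    \<le> besicovitch_pseudodist G S c1 c2"
proof -
  obtain r where r: "g \<in> U r" using balls_exhaust[OF g] .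
  let ?u = "\<lambda>n. ereal (difference_density G S c1 c2 n)"
  let ?v = "\<lambda>n. ereal (real (card (U (n + r))) / real (card (U n)) - 1)"
  have "(\<lambda>n. real (card (U (n + r))) / real (card (U n)) - 1) \<longlonglongrightarrow> 1 - 1"
    by (intro tendsto_intros ball_ratio_tendsto_1[OF poly])
  then have "?v \<longlonglongrightarrow> ereal 0" by simp
  then have v: "limsup ?v = 0" by (simp add: lim_imp_Limsup flip: zero_ereal_def)
  have "ereal (besicovitch_pseudodist G S (translate G c1 g) (translate G c2 g))
      \<le> limsup (\<lambda>n. ?u (n + r) + ?v n)"
    unfolding ereal_besicovitch_pseudodist[OF finite_generators]
    by (rule Limsup_mono) (simp add: difference_density_translate[OF r])
  also have "\<dots> \<le> limsup (\<lambda>n. ?u (n + r)) + limsup ?v"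
    by (rule ereal_limsup_add_mono)
  also have "\<dots> = limsup ?u"
    unfolding v using limsup_shift_k[of ?u r] by simp
  also have "\<dots> = ereal (besicovitch_pseudodist G S c1 c2)"
    by (simp add: ereal_besicovitch_pseudodist[OF finite_generators])
  finally show ?thesis by simp
qed

lemma pseudodist_cong:
  assumes "\<And>g. g \<in> carrier G \<Longrightarrow> c1 g = d1 g" "\<And>g. g \<in> carrier G \<Longrightarrow> c2 g = d2 g"
  shows "besicovitch_pseudodist G S c1 c2 = besicovitch_pseudodist G S d1 d2"
proof -
  have "{g \<in> U n. c1 g \<noteq> c2 g} = {g \<in> U n. d1 g \<noteq> d2 g}" for n
    using assms ball_closed by auto
  then show ?thesis
    by (simp add: besicovitch_pseudodist_def difference_density_def)
qed

text \<open>The inequality suffices, because translating back by \<open>inv g\<close> gives the reverse one.\<close>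

lemma pseudodist_translate:
  assumes poly: "polynomial_growth G" and g: "g \<in> carrier G"
  shows "besicovitch_pseudodist G S (translate G c1 g) (translate G c2 g)
    = besicovitch_pseudodist G S c1 c2"
proof (rule antisym)
  have undo: "translate G (translate G c1 g) (inv g) h = c1 h"
    "translate G (translate G c2 g) (inv g) h = c2 h" if "h \<in> carrier G" for h
    using that g by (simp_all add: translate_def m_assoc[symmetric])
  have "besicovitch_pseudodist G S c1 c2
      = besicovitch_pseudodist G S (translate G (translate G c1 g) (inv g))
          (translate G (translate G c2 g) (inv g))"
    by (rule pseudodist_cong) (simp_all add: undo)
  also have "\<dots> \<le> besicovitch_pseudodist G S (translate G c1 g) (translate G c2 g)"
    by (rule pseudodist_translate_le[OF poly]) (use g in simp)
  finally show "besicovitch_pseudodist G S c1 c2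
      \<le> besicovitch_pseudodist G S (translate G c1 g) (translate G c2 g)" .
qed (rule pseudodist_translate_le[OF poly g])

lemma difference_density_tendsto_0_change:
  assumes poly: "polynomial_growth G" and T: "group_with_generators G T"
    and lim: "difference_density G S c1 c2 \<longlonglongrightarrow> 0"
  shows "difference_density G T c1 c2 \<longlonglongrightarrow> 0"
proof -
  interpret T: group_with_generators G T by (rule T)
  obtain a where a: "a \<ge> 1" "\<And>n. T.U n \<subseteq> U (a * n)"
    using ball_change_generators[OF T] by metis
  obtain K n1 where K: "K > 0" "\<And>n. n \<ge> n1 \<Longrightarrow> real (card (U (a * n))) \<le> K * real (card (T.U n))"
    using polynomial_ball_comparison[OF poly group_with_generators_axioms T a(1)] by metis
  have bound: "difference_density G T c1 c2 n \<le> K * difference_density G S c1 c2 (a * n)"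
    if n: "n \<ge> n1" for n
  proof -
    have "card {g \<in> T.U n. c1 g \<noteq> c2 g} \<le> card {g \<in> U (a * n). c1 g \<noteq> c2 g}"
      using a(2) by (intro card_mono) auto
    then have num: "real (card {g \<in> T.U n. c1 g \<noteq> c2 g}) \<le> real (card {g \<in> U (a * n). c1 g \<noteq> c2 g})"
      by simp
    have pos: "real (card (T.U n)) > 0" "real (card (U (a * n))) > 0"
      using T.card_ball_pos card_ball_pos by simp_all
    have "real (card {g \<in> T.U n. c1 g \<noteq> c2 g}) * real (card (U (a * n)))
        \<le> real (card {g \<in> U (a * n). c1 g \<noteq> c2 g}) * (K * real (card (T.U n)))"
      by (rule mult_mono[OF num K(2)[OF n]]) simp_all
    then show ?thesis
      using pos by (simp add: difference_density_def divide_simps mult_ac)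
  qed
  have "strict_mono (\<lambda>n. a * n)"
    using a(1) by (simp add: strict_mono_def)
  from LIMSEQ_subseq_LIMSEQ[OF lim this]
  have "(\<lambda>n. K * difference_density G S c1 c2 (a * n)) \<longlonglongrightarrow> K * 0"
    by (intro tendsto_mult_left) (simp add: o_def)
  then have upper: "(\<lambda>n. K * difference_density G S c1 c2 (a * n)) \<longlonglongrightarrow> 0"
    by simp
  show ?thesis
  proof (rule tendsto_sandwich[OF _ _ tendsto_const upper])
    show "\<forall>\<^sub>F n in sequentially. 0 \<le> difference_density G T c1 c2 n"
      by (simp add: difference_density_nonneg)
    show "\<forall>\<^sub>F n in sequentially. difference_density G T c1 c2 n
        \<le> K * difference_density G S c1 c2 (a * n)"
      using bound eventually_sequentially by blast
  qed
qed

lemma besicovitch_space_change: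
  assumes poly: "polynomial_growth G" and T: "group_with_generators G T"
  shows "besicovitch_space G T Q = besicovitch_space G S Q"
proof -
  interpret T: group_with_generators G T by (rule T)
  have "besicovitch_rel G T Q = besicovitch_rel G S Q"
    using difference_density_tendsto_0_change[OF poly T]
      T.difference_density_tendsto_0_change[OF poly group_with_generators_axioms]
    unfolding besicovitch_rel_def by blast
  then show ?thesis by (simp add: besicovitch_space_def)
qed

end

section \<open>Cellular automata on the Besicovitch space\<close>

theorem theorem1p1:
  fixes G :: "('g, 'm) monoid_scheme"
    and S N :: "'g set"
    and Q :: "'q set"
    and f :: "('g \<Rightarrow> 'q) \<Rightarrow> 'q"
  assumes "group G"
    and "infinite (carrier G)"
    and "subexponential_growth G"
    and "finite_generating_set G S"
    and "cellular_automaton G Q N f"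
  shows
    "(\<exists>F \<in> besicovitch_space G S Q \<rightarrow>\<^sub>E besicovitch_space G S Q.
        (\<forall>c \<in> configs G Q.
          F (besicovitch_class G S Q c) = besicovitch_class G S Q (global_map G N f c)) \<and>
        (\<exists>L::real. L > 0 \<and>
          (\<forall>x1 \<in> besicovitch_space G S Q. \<forall>x2 \<in> besicovitch_space G S Q.
            besicovitch_dist G S (F x1) (F x2) \<le> L * besicovitch_dist G S x1 x2)) \<and>
        (F ` besicovitch_space G S Q = besicovitch_space G S Q \<longleftrightarrow>
          global_map G N f ` configs G Q = configs G Q) \<and>
        (inj_on F (besicovitch_space G S Q) \<longleftrightarrow>
          bij_betw F (besicovitch_space G S Q) (besicovitch_space G S Q))) \<and>
     (polynomial_growth G \<longrightarrow>
        (\<forall>c1 \<in> configs G Q. \<forall>c2 \<in> configs G Q. \<forall>g \<in> carrier G.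
          besicovitch_pseudodist G S (translate G c1 g) (translate G c2 g) =
          besicovitch_pseudodist G S c1 c2) \<and>
        (\<forall>T. finite_generating_set G T \<longrightarrow>
          besicovitch_space G T Q = besicovitch_space G S Q))"
proof -
  interpret automaton_with_generators G S Q N f
    using assms by (intro automaton_with_generators.intro group_with_generators.intro
        automaton_on_group.intro group_with_generators_axioms.intro automaton_on_group_axioms.intro)
  show ?thesis
  proof (intro conjI impI ballI allI)
    obtain L where L: "L > 0"
      "\<forall>x1\<in>besicovitch_space G S Q. \<forall>x2\<in>besicovitch_space G S Q.
        besicovitch_dist G S (induced_map x1) (induced_map x2) \<le> L * besicovitch_dist G S x1 x2"
      by (rule induced_map_lipschitz)
    show "\<exists>F \<in> besicovitch_space G S Q \<rightarrow>\<^sub>E besicovitch_space G S Q.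
        (\<forall>c \<in> configs G Q.
          F (besicovitch_class G S Q c) = besicovitch_class G S Q (global_map G N f c)) \<and>
        (\<exists>L::real. L > 0 \<and>
          (\<forall>x1 \<in> besicovitch_space G S Q. \<forall>x2 \<in> besicovitch_space G S Q.
            besicovitch_dist G S (F x1) (F x2) \<le> L * besicovitch_dist G S x1 x2)) \<and>
        (F ` besicovitch_space G S Q = besicovitch_space G S Q \<longleftrightarrow>
          global_map G N f ` configs G Q = configs G Q) \<and>
        (inj_on F (besicovitch_space G S Q) \<longleftrightarrow>
          bij_betw F (besicovitch_space G S Q) (besicovitch_space G S Q))"
    proof (intro bexI[of _ induced_map] conjI exI[of _ L] ballI)
      show "inj_on induced_map (besicovitch_space G S Q) \<longleftrightarrow>
          bij_betw induced_map (besicovitch_space G S Q) (besicovitch_space G S Q)"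
        by (rule induced_map_injective_iff[OF assms(3)])
    qed (use L induced_map_class induced_map_surjective_iff induced_map_closed in auto)
  next
    fix c1 c2 :: "'g \<Rightarrow> 'q" and g
    assume "polynomial_growth G" "g \<in> carrier G"
    then show "besicovitch_pseudodist G S (translate G c1 g) (translate G c2 g) =
        besicovitch_pseudodist G S c1 c2"
      by (rule pseudodist_translate)
  next
    fix T assume "polynomial_growth G" "finite_generating_set G T"
    then show "besicovitch_space G T Q = besicovitch_space G S Q"
      by (intro besicovitch_space_change group_with_generators.intro assms(1)
          group_with_generators_axioms.intro)
  qed
qed

end
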